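(* Let $(X_t)_{t\ge0}$ be an ergodic Feller process on $E$ with generator $\mathcal{L}$ and invariant measure $\pi$, let $(E_i,\mathcal{L}_i,\pi_i)$, $i=1,\dots,n$, be identical copies of $(E,\mathcal{L},\pi)$, and let $\Gamma\in\mathcal{G}^0$ be an ergodic coupling operator with generator $\bar{\mathcal{L}}_\Gamma$, semigroup $(\bar S_t^\Gamma)_{t\ge0}$ and invariant measure $\bar\pi_\Gamma$ on $\bar E=E^n$. Let $$\tilde L_0^2(\bar\pi_\Gamma)=\Big\{F\in L_0^2(\bar\pi_\Gamma)\ :\ \text{there exists } f\in L_0^2(\pi)\text{ such that }F=\tfrac1n\sum_{i=1}^nf_i\Big\},\qquad f_i(x_1,\dots,x_n)=f(x_i).$$ For $\Lambda>0$, the following are equivalent: 1. (Poincaré inequality) $\langle F,F\rangle_{L^2(\bar\pi_\Gamma)}\le\frac1\Lambda\langle F,(-\bar{\mathcal{L}}_\Gamma)F\rangle_{L^2(\bar\pi_\Gamma)}$ for all $F\in\mathcal{D}(\bar{\mathcal{L}}_\Gamma)\cap\tilde L_0^2(\bar\pi_\Gamma)$. 2. (Exponential decay) $\|\bar S_t^\Gamma F\|_{L^2(\bar\pi_\Gamma)}^2\le e^{-2\Lambda t}\|F\|^2_{L^2(\bar\pi_\Gamma)}$ for all $t\ge0$ and all $F\in\tilde L_0^2(\bar\pi_\Gamma)$.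
   Context: State spaces are locally compact Polish spaces with a differentiable structure. A Markov process is Feller if its semigroup preserves $C_0$ and is strongly continuous on it; all Feller processes are assumed to have $C_c^\infty$ in the domain of their generator, and $C_c^\infty(E_i)$ is a core for $\mathcal{L}_i$. Functions on $E_i$ are regarded as functions on $\bar E=E_1\times\dots\times E_n$ depending only on $x_i$; $\mathcal{L}_i$ acts on the $i$-th variable. Ergodicity: there is a unique probability measure $\pi$ with $\int\mathcal{L}f\,\mathrm{d}\pi=0$ for $f\in\mathcal{D}(\mathcal{L})$, and $\lim_{T\to\infty}\frac1T\int_0^Tf(X_t)\,\mathrm{d}t=\int f\,\mathrm{d}\pi$ for $f\in C_b(E)$. $L_0^2(\mu)=\{f\in L^2(\mu):\mu(f)=0\}$. Coupling operators: $\mathcal{G}$ is the set of linear operators $(\Gamma,\mathcal{D}(\Gamma))$ on $\mathcal{B}_b(\bar E)$ such that (1) for all $i$ and $f\in C_c^\infty(E_i)$, $f\in\mathcal{D}(\Gamma)$ and $\Gamma f=0$; (2) $\bar{\mathcal{L}}_\Gamma=\sum_i\mathcal{L}_i+\Gamma$ with domain $\bigotimes_i\mathcal{D}(\mathcal{L}_i)\cap\mathcal{D}(\Gamma)$ is closable and its closure (same symbol) generates a Feller process $(\bar X_t)$ on $\bar E$ with semigroup $(\bar S_t^\Gamma)$. This process is a coupling of the one-particle processes (its $i$-th coordinate process has the law of $(X^i_t)$). $\mathcal{G}^0\subset\mathcal{G}$ consists of those $\Gamma$ for which $(\bar X_t)$ is ergodic; its unique invariant measure $\bar\pi_\Gamma$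 has all marginals equal to $\pi$. The semigroup $(\bar S_t^\Gamma)$ and generator $\bar{\mathcal{L}}_\Gamma$ are extended to a strongly continuous semigroup on $L^2(\bar\pi_\Gamma)$ and its generator, denoted by the same symbols. *)

theory Defs
  imports "HOL-Probability.Probability"
begin

text \<open>
  A chart maps an open set homeomorphically onto a relatively open subset of the coordinate
  subspace spanned by a set of basis vectors of a Euclidean space. Working with coordinate
  subspaces allows any dimension from zero up to that of the ambient type, which may
  vary between connected components; the set of all basis vectors gives the usual charts.
\<close>

record ('b, 'm) chart =
  chart_dom :: "'b set"
  coords :: "'b \<Rightarrow> 'm"
  dirs :: "'m set"

primrec Ck_on :: "nat \<Rightarrow> 'm::euclidean_space set \<Rightarrow> 'm set \<Rightarrow> ('m \<Rightarrow> real) \<Rightarrow> bool" where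
  "Ck_on 0 B S f \<longleftrightarrow> continuous_on S f"
| "Ck_on (Suc k) B S f \<longleftrightarrow> continuous_on S f \<and>
     (\<forall>b\<in>B. \<exists>g. Ck_on k B S g \<and>
        (\<forall>x\<in>S. ((\<lambda>t. f (x + t *\<^sub>R b)) has_real_derivative g x) (at 0)))"

definition smooth_on :: "'m::euclidean_space set \<Rightarrow> 'm set \<Rightarrow> ('m \<Rightarrow> real) \<Rightarrow> bool" where
  "smooth_on B S f \<longleftrightarrow> (\<forall>k. Ck_on k B S f)"

definition is_chart :: "('b::topological_space, 'm::euclidean_space) chart \<Rightarrow> bool" where
  "is_chart c \<longleftrightarrow> open (chart_dom c) \<and> dirs c \<subseteq> Basis \<and>
     openin (top_of_set (span (dirs c))) (coords c ` chart_dom c) \<and>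
     homeomorphism (chart_dom c) (coords c ` chart_dom c) (coords c) (inv_into (chart_dom c) (coords c))"

definition smooth_atlas :: "('b::topological_space, 'm::euclidean_space) chart set \<Rightarrow> bool" where
  "smooth_atlas A \<longleftrightarrow> (\<forall>c\<in>A. is_chart c) \<and> (\<Union>c\<in>A. chart_dom c) = UNIV \<and>
     (\<forall>c\<in>A. \<forall>d\<in>A. \<forall>b\<in>Basis.
        smooth_on (dirs c) (coords c ` (chart_dom c \<inter> chart_dom d))
          (\<lambda>y. coords d (inv_into (chart_dom c) (coords c) y) \<bullet> b))"

definition product_chart :: "('n::finite \<Rightarrow> ('a, 'm::euclidean_space) chart) \<Rightarrow> ('a ^ 'n, 'm ^ 'n) chart"
  where
  "product_chart c =
     \<lparr>chart_dom = {x. \<forall>i. x $ i \<in> chart_dom (c i)},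
      coords = (\<lambda>x. \<chi> i. coords (c i) (x $ i)),
      dirs = {axis i b | i b. b \<in> dirs (c i)}\<rparr>"

definition product_atlas :: "('a, 'm::euclidean_space) chart set \<Rightarrow> ('a ^ 'n::finite, 'm ^ 'n) chart set"
  where
  "product_atlas A = {product_chart c | c. \<forall>i. c i \<in> A}"

definition Cc_smooth :: "('b::topological_space, 'm::euclidean_space) chart set \<Rightarrow> ('b \<Rightarrow> real) set"
  where
  "Cc_smooth A = {f. compact (closure {x. f x \<noteq> 0}) \<and>
     (\<forall>c\<in>A. smooth_on (dirs c) (coords c ` chart_dom c) (\<lambda>y. f (inv_into (chart_dom c) (coords c) y)))}"


definition C0 :: "('b::topological_space \<Rightarrow> real) set" where
  "C0 = {f. continuous_on UNIV f \<and> (\<forall>e>0. \<exists>K. compact K \<and> (\<forall>x. x \<notin> K \<longrightarrow> \<bar>f x\<bar> < e))}"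

definition Cb :: "('b::topological_space \<Rightarrow> real) set" where
  "Cb = {f. continuous_on UNIV f \<and> bounded (range f)}"

definition Bb :: "('b::topological_space \<Rightarrow> real) set" where
  "Bb = {f. f \<in> borel_measurable borel \<and> bounded (range f)}"

text \<open>Operators on function spaces are given by their graphs.\<close>

type_synonym 'b op = "(('b \<Rightarrow> real) \<times> ('b \<Rightarrow> real)) set"

definition linear_operator :: "'b op \<Rightarrow> bool" where
  "linear_operator L \<longleftrightarrow> single_valued L \<and> (\<lambda>_. 0, \<lambda>_. 0) \<in> L \<and>
     (\<forall>f g f' g' a b. (f, g) \<in> L \<longrightarrow> (f', g') \<in> L \<longrightarrow>
        (\<lambda>x. a * f x + b * f' x, \<lambda>x. a * g x + b * g' x) \<in> L)"

definition op_apply :: "'b op \<Rightarrow> ('b \<Rightarrow> real) \<Rightarrow> ('b \<Rightarrow> real)" where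
  "op_apply L f = (THE g. (f, g) \<in> L)"

definition op_closure :: "'b op \<Rightarrow> 'b op" where
  "op_closure L = {(f, g). \<exists>F G. (\<forall>k::nat. (F k, G k) \<in> L) \<and>
     uniform_limit UNIV F f sequentially \<and> uniform_limit UNIV G g sequentially}"

definition closable :: "'b op \<Rightarrow> bool" where
  "closable L \<longleftrightarrow> single_valued (op_closure L)"

definition is_core :: "('b \<Rightarrow> real) set \<Rightarrow> 'b op \<Rightarrow> bool" where
  "is_core D L \<longleftrightarrow> D \<subseteq> Domain L \<and> op_closure {(f, g) \<in> L. f \<in> D} = L"


text \<open>
  A Markov process is a process \<open>X\<close> on a measurable space together with the family of
  its laws indexed by the starting point. Only the sigma-algebra of \<open>sample_space\<close> matters.
\<close>

record ('b, 'w) process =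
  sample_space :: "'w measure"
  law_from :: "'b \<Rightarrow> 'w measure"
  state :: "real \<Rightarrow> 'w \<Rightarrow> 'b"

definition natural_filtration :: "('b::topological_space, 'w) process \<Rightarrow> real \<Rightarrow> 'w measure" where
  "natural_filtration X t = sigma (space (sample_space X))
     {state X s -` A \<inter> space (sample_space X) | s A. 0 \<le> s \<and> s \<le> t \<and> A \<in> sets borel}"

text \<open>
  The formula below makes sense for bounded measurable functions and, almost everywhere
  with respect to an invariant probability measure \<open>\<mu>\<close>, for functions in \<open>L\<^sup>2(\<mu>)\<close>. On
  \<open>L\<^sup>2(\<mu>)\<close> it is a contraction, so it gives the continuous extension of the semigroup on \<open>C\<^sub>0\<close>.
\<close>

definition semigroup_of :: "('b, 'w) process \<Rightarrow> real \<Rightarrow> ('b \<Rightarrow> real) \<Rightarrow> ('b \<Rightarrow> real)" where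
  "semigroup_of X t f x = (\<integral>\<omega>. f (state X t \<omega>) \<partial>law_from X x)"

definition markov_process :: "('b::topological_space, 'w) process \<Rightarrow> bool" where
  "markov_process X \<longleftrightarrow>
     law_from X \<in> borel \<rightarrow>\<^sub>M prob_algebra (sample_space X) \<and>
     (\<forall>t\<ge>0. state X t \<in> sample_space X \<rightarrow>\<^sub>M borel) \<and>
     (\<forall>x. AE \<omega> in law_from X x. state X 0 \<omega> = x) \<and>
     (\<forall>x. \<forall>s\<ge>0. \<forall>t\<ge>0. \<forall>f\<in>Bb. AE \<omega> in law_from X x.
        real_cond_exp (law_from X x) (natural_filtration X s) (\<lambda>\<omega>. f (state X (s + t) \<omega>)) \<omega>
          = semigroup_of X t f (state X s \<omega>))"

definition generator :: "('b::topological_space, 'w) process \<Rightarrow> 'b op" where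
  "generator X = {(f, g). f \<in> C0 \<and> g \<in> C0 \<and>
     uniform_limit UNIV (\<lambda>t x. (semigroup_of X t f x - f x) / t) g (at_right 0)}"

definition feller_process ::
    "('b::topological_space, 'm::euclidean_space) chart set \<Rightarrow> ('b, 'w) process \<Rightarrow> bool" where
  "feller_process A X \<longleftrightarrow> markov_process X \<and>
     (\<forall>t\<ge>0. \<forall>f\<in>C0. semigroup_of X t f \<in> C0) \<and>
     (\<forall>f\<in>C0. uniform_limit UNIV (\<lambda>t. semigroup_of X t f) f (at_right 0)) \<and>
     Cc_smooth A \<subseteq> Domain (generator X)"

definition invariant_measure :: "('b::topological_space, 'w) process \<Rightarrow> 'b measure \<Rightarrow> bool" where
  "invariant_measure X \<mu> \<longleftrightarrow> prob_space \<mu> \<and> sets \<mu> = sets borel \<and>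
     (\<forall>(f, g)\<in>generator X. (\<integral>x. g x \<partial>\<mu>) = 0)"

text \<open>
  Paths are not assumed right-continuous, so the existence of the time integrals is part of
  the ergodic property; it is automatic for cadlag paths.
\<close>

definition ergodic :: "('b::topological_space, 'w) process \<Rightarrow> 'b measure \<Rightarrow> bool" where
  "ergodic X \<mu> \<longleftrightarrow> invariant_measure X \<mu> \<and> (\<forall>\<nu>. invariant_measure X \<nu> \<longrightarrow> \<nu> = \<mu>) \<and>
     (\<forall>x. \<forall>f\<in>Cb. AE \<omega> in law_from X x.
        (\<forall>T>0. set_integrable lborel {0..T} (\<lambda>t. f (state X t \<omega>))) \<and>
        ((\<lambda>T. 1 / T * (LBINT t:{0..T}. f (state X t \<omega>))) \<longlongrightarrow> (\<integral>y. f y \<partial>\<mu>)) at_top)"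


definition tensor_domain :: "('a \<Rightarrow> real) set \<Rightarrow> ('a ^ 'n::finite \<Rightarrow> real) set" where
  "tensor_domain D = {F. \<exists>(m::nat) \<phi>. (\<forall>k<m. \<forall>i. \<phi> k i \<in> D) \<and>
     F = (\<lambda>x. \<Sum>k<m. \<Prod>i\<in>UNIV. \<phi> k i (x $ i))}"

definition act_on :: "'n::finite \<Rightarrow> 'a op \<Rightarrow> ('a ^ 'n \<Rightarrow> real) \<Rightarrow> ('a ^ 'n \<Rightarrow> real)" where
  "act_on i L F x = op_apply L (\<lambda>y. F (\<chi> j. if j = i then y else x $ j)) (x $ i)"

definition coupled_generator :: "'a op \<Rightarrow> ('a ^ 'n::finite) op \<Rightarrow> ('a ^ 'n) op" where
  "coupled_generator L \<Gamma> = {(F, \<lambda>x. (\<Sum>i\<in>UNIV. act_on i L F x) + op_apply \<Gamma> F x) | F.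
     F \<in> tensor_domain (Domain L) \<inter> Domain \<Gamma>}"

definition is_coupling ::
    "('a::topological_space, 'w) process \<Rightarrow> ('a ^ 'n::finite, 'v) process \<Rightarrow> bool" where
  "is_coupling X Y \<longleftrightarrow> (\<forall>x i.
     distr (law_from Y x) (\<Pi>\<^sub>M t\<in>{0..}. borel) (\<lambda>\<omega>. \<lambda>t\<in>{0..}. state Y t \<omega> $ i) =
     distr (law_from X (x $ i)) (\<Pi>\<^sub>M t\<in>{0..}. borel) (\<lambda>\<omega>. \<lambda>t\<in>{0..}. state X t \<omega>))"

text \<open>
  The coupling operators whose closed generator generates the Feller process \<open>Y\<close>; the
  generator determines the law of \<open>Y\<close>. If the state space is not compact, functions of one
  coordinate do not vanish at infinity on the product and hence do not lie in the domain of
  its generator. The last clause therefore records explicitly that \<open>Y\<close> is a coupling of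
  copies of \<open>X\<close>.
\<close>

definition coupling_operators ::
    "('a::topological_space, 'm::euclidean_space) chart set \<Rightarrow> ('a, 'w) process \<Rightarrow>
     ('a ^ 'n::finite, 'v) process \<Rightarrow> ('a ^ 'n) op set" where
  "coupling_operators A X Y = {\<Gamma>. linear_operator \<Gamma> \<and> \<Gamma> \<subseteq> Bb \<times> Bb \<and>
     (\<forall>i. \<forall>f\<in>Cc_smooth A. (\<lambda>x. f (x $ i), \<lambda>_. 0) \<in> \<Gamma>) \<and>
     closable (coupled_generator (generator X) \<Gamma>) \<and>
     feller_process (product_atlas A) Y \<and>
     op_closure (coupled_generator (generator X) \<Gamma>) = generator Y \<and>
     is_coupling X Y}"

definition ergodic_coupling_operators ::
    "('a::topological_space, 'm::euclidean_space) chart set \<Rightarrow> ('a, 'w) process \<Rightarrow>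
     ('a ^ 'n::finite, 'v) process \<Rightarrow> ('a ^ 'n) measure \<Rightarrow> ('a ^ 'n) op set" where
  "ergodic_coupling_operators A X Y \<mu> = {\<Gamma> \<in> coupling_operators A X Y. ergodic Y \<mu>}"


text \<open>
  Elements of \<open>L\<^sup>2\<close> are represented by measurable functions, with equality almost everywhere.
  In particular the second component of \<open>L2_generator\<close> is only determined up to null sets.
\<close>

definition L2 :: "'b measure \<Rightarrow> ('b \<Rightarrow> real) set" where
  "L2 \<mu> = {f. f \<in> borel_measurable \<mu> \<and> integrable \<mu> (\<lambda>x. (f x)\<^sup>2)}"

definition L2_inner :: "'b measure \<Rightarrow> ('b \<Rightarrow> real) \<Rightarrow> ('b \<Rightarrow> real) \<Rightarrow> real" where
  "L2_inner \<mu> f g = (\<integral>x. f x * g x \<partial>\<mu>)"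

definition L2_norm :: "'b measure \<Rightarrow> ('b \<Rightarrow> real) \<Rightarrow> real" where
  "L2_norm \<mu> f = sqrt (L2_inner \<mu> f f)"

definition L2_mean_zero :: "'b measure \<Rightarrow> ('b \<Rightarrow> real) set" where
  "L2_mean_zero \<mu> = {f \<in> L2 \<mu>. (\<integral>x. f x \<partial>\<mu>) = 0}"

definition L2_averages :: "'a measure \<Rightarrow> ('a ^ 'n::finite) measure \<Rightarrow> ('a ^ 'n \<Rightarrow> real) set" where
  "L2_averages \<pi> \<mu> = {F \<in> L2_mean_zero \<mu>. \<exists>f\<in>L2_mean_zero \<pi>.
     AE x in \<mu>. F x = 1 / real CARD('n) * (\<Sum>i\<in>UNIV. f (x $ i))}"

definition L2_generator :: "('b, 'w) process \<Rightarrow> 'b measure \<Rightarrow> 'b op" where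
  "L2_generator X \<mu> = {(F, G). F \<in> L2 \<mu> \<and> G \<in> L2 \<mu> \<and>
     ((\<lambda>t. L2_norm \<mu> (\<lambda>x. (semigroup_of X t F x - F x) / t - G x)) \<longlongrightarrow> 0) (at_right 0)}"

end

theory Submission
  imports Defs
begin

text \<open>
  By the coupling property, the semigroup of \<open>Y\<close> acts on functions of a single coordinate as the
  semigroup of \<open>X\<close>, and by uniqueness of the invariant measure of \<open>X\<close> the marginals of \<open>\<pi>\<^sub>\<Gamma>\<close> are \<open>\<pi>\<close>.
  Hence averages of functions of single coordinates are preserved by the semigroup of \<open>Y\<close>.
  Decay implies the Poincare inequality by differentiating \<open>\<parallel>S\<^sub>t F\<parallel>\<^sup>2\<close> at \<open>t = 0\<close>. Conversely, if
  \<open>F\<close> is the average of a centred function in the domain of the generator of \<open>X\<close>, then so is every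
  \<open>S\<^sub>t F\<close>, and the Poincare inequality makes \<open>exp (2 \<Lambda> t) \<parallel>S\<^sub>t F\<parallel>\<^sup>2\<close> nonincreasing. Such \<open>F\<close> are
  dense, because the time averages \<open>1/h \<integral>\<^sub>0\<^sup>h S\<^sub>s f ds\<close> make the domain dense in \<open>C\<^sub>0\<close> and \<open>C\<^sub>0\<close> is dense
  in \<open>L\<^sup>2(\<pi>)\<close>. The same time averages turn the infinitesimal condition that defines an invariant
  measure into invariance under the transition kernels, which makes the semigroup a contraction
  of \<open>L\<^sup>2\<close>.
\<close>

section \<open>Locally compact Polish product spaces\<close>

text \<open>The Poincare inequality is assumed on averages only, so an approximation of F must stay
  inside that class; an arbitrary domain vector of \<open>Y\<close> close to F would not help.
  Suitable domain vectors are therefore built on one copy of the state space and lifted by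
  \<open>coordinate_average\<close>, which is a contraction between the L2 spaces because all
  marginals agree. Elements of \<open>L2\<close> are plain functions rather than vectors of a normed
  type, so differentiation and integration in time take place in the Banach space of bounded
  continuous functions with the sup norm, and a bounded bilinear form carries the result to L2. Two
  obstacles shape the details. Nonzero constants, subtracted for centring, lie outside
  \<open>C0\<close> on a noncompact space, so curves move in the larger space of bounded continuous
  functions. And an unbounded L2 function is guaranteed to be integrable against the transition
  kernel only at almost every starting point, so linearity of the L2 semigroup is an
  almost-everywhere statement that rests on invariance for all Borel functions.\<close>

instance vec :: ("{metric_space, second_countable_topology}", finite) second_countable_topology
proof
  obtain B :: "'a set set" where B: "countable B" "topological_basis B"
    using ex_countable_basis by blast
  define C :: "('a ^ 'b) set set" where "C = (\<lambda>S. {x. \<forall>i. x $ i \<in> S i}) ` (PiE UNIV (\<lambda>_. B))"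
  have "topological_basis C"
  proof (rule topological_basisI)
    fix U assume "U \<in> C"
    then show "open U"
      using B(2) by (auto simp: C_def PiE_iff intro!: open_vector_box topological_basis_open)
  next
    fix U :: "('a ^ 'b) set" and x assume "open U" "x \<in> U"
    then obtain A where A: "\<And>i. open (A i) \<and> x $ i \<in> A i"
      and AU: "\<And>y. (\<forall>i. y $ i \<in> A i) \<Longrightarrow> y \<in> U"
      unfolding open_vec_def by metis
    have "\<forall>i. \<exists>S\<in>B. x $ i \<in> S \<and> S \<subseteq> A i"
      using A B(2) by (metis topological_basisE)
    then obtain S where S: "\<And>i. S i \<in> B" "\<And>i. x $ i \<in> S i" "\<And>i. S i \<subseteq> A i"
      by metis
    have "{y. \<forall>i. y $ i \<in> S i} \<in> C" using S(1) by (auto simp: C_def PiE_iff)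
    moreover have "{y. \<forall>i. y $ i \<in> S i} \<subseteq> U" using S(3) AU by blast
    ultimately show "\<exists>V\<in>C. x \<in> V \<and> V \<subseteq> U"
      by (intro bexI[of _ "{y. \<forall>i. y $ i \<in> S i}"]) (simp_all add: S(2))
  qed
  moreover have "countable C"
    unfolding C_def using B(1) by (intro countable_image countable_PiE) auto
  ultimately show "\<exists>B :: ('a ^ 'b) set set. countable B \<and> open = generate_topology B"
    using topological_basis_imp_subbasis by blast
qed

text \<open>The locale \<open>feller\<close> and inner regularity of Borel measures both ask for
  \<open>polish_space\<close>; this opens them to the state space of \<open>Y\<close>.\<close>

instance vec :: (polish_space, finite) polish_space ..

text \<open>Tychonoff in the function space, carried over by the continuous map
  \<open>vec_lambda\<close>.\<close>

lemma compact_vector_box: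
  fixes S :: "'n::finite \<Rightarrow> 'a::topological_space set"
  assumes "\<And>i. compact (S i)"
  shows "compact {x :: 'a ^ 'n. \<forall>i. x $ i \<in> S i}"
proof -
  have "compactin (product_topology (\<lambda>i. euclidean) UNIV) (PiE UNIV S)"
    using assms by (auto simp: compactin_PiE)
  then have "compact (PiE UNIV S)"
    by (simp add: euclidean_product_topology)
  moreover have "continuous_on (PiE UNIV S) (vec_lambda :: _ \<Rightarrow> 'a ^ 'n)"
    by (intro continuous_on_vec_lambda continuous_on_subset[OF continuous_on_product_coordinates]) simp
  ultimately have "compact ((vec_lambda :: _ \<Rightarrow> 'a ^ 'n) ` PiE UNIV S)"
    by (rule compact_continuous_image[rotated])
  also have "(vec_lambda :: _ \<Rightarrow> 'a ^ 'n) ` PiE UNIV S = {x. \<forall>i. x $ i \<in> S i}"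
  proof (intro equalityI subsetI)
    fix x :: "'a ^ 'n" assume "x \<in> {x. \<forall>i. x $ i \<in> S i}"
    then show "x \<in> vec_lambda ` PiE UNIV S"
      by (intro image_eqI[of _ _ "vec_nth x"]) (auto simp: vec_nth_inverse)
  qed auto
  finally show ?thesis .
qed

lemma locally_compact_vec:
  assumes "locally compact (UNIV :: 'a::metric_space set)"
  shows "locally compact (UNIV :: ('a ^ 'n::finite) set)"
  unfolding locally_compact
proof
  fix x :: "'a ^ 'n"
  obtain U V where UV: "\<And>y::'a. y \<in> U y \<and> U y \<subseteq> V y \<and> open (U y) \<and> compact (V y)"
    using locally_compactE[OF assms] by (metis UNIV_I open_openin subtopology_UNIV)
  show "\<exists>U V. x \<in> U \<and> U \<subseteq> V \<and> V \<subseteq> UNIV \<and> openin (top_of_set UNIV) U \<and> compact V"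
  proof (intro exI conjI)
    show "openin (top_of_set UNIV) {y. \<forall>i. y $ i \<in> U (x $ i)}"
      using UV by (simp add: open_vector_box)
    show "compact {y. \<forall>i. y $ i \<in> V (x $ i)}"
      using UV by (intro compact_vector_box) auto
  qed (use UV in auto)
qed

text \<open>Ever steeper tents over \<open>K\<close>, falling off linearly in the distance to
  \<open>K\<close>. Local compactness yields a compact \<open>C\<close> containing a
  \<open>d\<close>-neighbourhood of \<open>K\<close>, and a slope of at least \<open>1 / d\<close>
  makes every tent vanish outside \<open>C\<close>.\<close>

lemma C0_approx_compact:
  fixes K :: "'a::metric_space set"
  assumes lc: "locally compact (UNIV :: 'a set)" and K: "compact K"
  obtains f :: "nat \<Rightarrow> 'a \<Rightarrow> real" where "\<And>m. f m \<in> C0" "\<And>m x. 0 \<le> f m x \<and> f m x \<le> 1"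
    "\<And>x. (\<lambda>m. f m x) \<longlonglongrightarrow> indicator K x"
\<comment> \<open>\<open>infdist\<close> to the empty set is 0, so the tents would be constantly 1
  here.\<close>
proof (cases "K = {}")
  case True
  then show ?thesis by (intro that[of "\<lambda>_ _. 0"]) (auto simp: C0_def)
next
  case False
  obtain U V where UV: "\<And>y::'a. y \<in> U y \<and> U y \<subseteq> V y \<and> open (U y) \<and> compact (V y)"
    using locally_compactE[OF lc] by (metis UNIV_I open_openin subtopology_UNIV)
  have "K \<subseteq> (\<Union>y\<in>K. U y)" using UV by auto
  then obtain I where I: "I \<subseteq> K" "finite I" "K \<subseteq> (\<Union>y\<in>I. U y)"
    using compactE_image[OF K, of K U] UV by metis
  define W where "W = (\<Union>y\<in>I. U y)"
  have W: "open W" "K \<subseteq> W" using UV I by (auto simp: W_def)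
  define C where "C = (\<Union>y\<in>I. V y)"
  have C: "compact C" "W \<subseteq> C" using UV I unfolding C_def W_def by (auto intro: compact_UN)
  \<comment> \<open>A uniform gap: the minimum over \<open>K\<close> of the distance to
    \<open>- W\<close>. If \<open>W\<close> is everything there is no complement to measure, and any
    positive number will do.\<close>
  obtain d where d: "d > 0" "\<And>x. infdist x K < d \<Longrightarrow> x \<in> W"
  proof (cases "W = UNIV")
    case True then show ?thesis using that[of 1] by auto
  next
    case F: False
    have "continuous_on K (\<lambda>x. infdist x (- W))" by (intro continuous_intros)
    then obtain z where z: "z \<in> K" "\<And>x. x \<in> K \<Longrightarrow> infdist z (- W) \<le> infdist x (- W)"
      using continuous_attains_inf[OF K False] by blast
    define d where "d = infdist z (- W)"
    have "closed (- W)" "- W \<noteq> {}" "z \<notin> - W" using W z F by auto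
    then have "d > 0"
      using in_closed_iff_infdist_zero[of "- W" z] infdist_nonneg[of z "- W"] by (auto simp: d_def)
    have d: "d \<le> dist x y" if "x \<in> K" "y \<in> - W" for x y
      using z(2)[OF that(1)] infdist_le[OF that(2), of x] by (simp add: d_def)
    have "x \<in> W" if "infdist x K < d" for x
    proof (rule ccontr)
      assume "x \<notin> W"
      then have "d \<le> infdist x K"
        using d False unfolding infdist_def by (auto intro!: cINF_greatest simp: dist_commute)
      with that show False by simp
    qed
    with \<open>d > 0\<close> show ?thesis using that by blast
  qed
  define f where "f m x = max 0 (1 - (real m + 1 / d) * infdist x K)" for m x
  show ?thesis
  proof (rule that[of f])
    fix m
    have "f m x = 0" if "x \<notin> C" for x
    proof -
      have "d \<le> infdist x K" using d(2)[of x] C that by force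
      then have "1 \<le> (1/d) * infdist x K" using d(1) by (simp add: field_simps)
      also have "\<dots> \<le> (real m + 1 / d) * infdist x K"
        by (intro mult_right_mono) (auto simp: infdist_nonneg)
      finally show ?thesis by (simp add: f_def)
    qed
    moreover have "continuous_on UNIV (f m)"
      unfolding f_def by (intro continuous_intros)
    ultimately show "f m \<in> C0"
      using C(1) by (fastforce simp: C0_def)
  next
    fix m x show "0 \<le> f m x \<and> f m x \<le> 1"
      using d(1) by (auto simp: f_def infdist_nonneg)
  next
    fix x
    show "(\<lambda>m. f m x) \<longlonglongrightarrow> indicator K x"
    proof (cases "x \<in> K")
      case True then show ?thesis by (simp add: f_def)
    next
      case nK: False
      have pos: "infdist x K > 0"
        using in_closed_iff_infdist_zero[of K x] infdist_nonneg[of x K] K False nK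
        by (auto simp: compact_imp_closed less_le)
      have "eventually (\<lambda>m. f m x = 0) sequentially"
      proof -
        obtain N :: nat where "1 / infdist x K < N" using reals_Archimedean2 by blast
        then have N: "1 < N * infdist x K" using pos by (simp add: field_simps)
        have "f m x = 0" if "m \<ge> N" for m
        proof -
          have "N * infdist x K \<le> (real m + 1 / d) * infdist x K"
            using that d(1) pos by (intro mult_right_mono) (auto intro: add_increasing2)
          then show ?thesis using N by (auto simp: f_def)
        qed
        then show ?thesis by (auto simp: eventually_sequentially)
      qed
      then show ?thesis using nK by (simp add: tendsto_eventually)
    qed
  qed
qed

section \<open>Function classes, and measures determined by \<open>C0\<close>\<close>

lemma C0_subset_Cb: "(C0 :: ('b::topological_space \<Rightarrow> real) set) \<subseteq> Cb"
proof
  fix f :: "'b \<Rightarrow> real" assume f: "f \<in> C0"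
  then obtain K where K: "compact K" "\<And>x. x \<notin> K \<Longrightarrow> \<bar>f x\<bar> < 1"
    unfolding C0_def by (auto dest: spec[of _ 1])
  have "compact (f ` K)" using f K by (intro compact_continuous_image) (auto simp: C0_def intro: continuous_on_subset)
  then obtain B where B: "\<forall>x\<in>K. \<bar>f x\<bar> \<le> B"
    by (auto dest!: compact_imp_bounded simp: bounded_iff)
  have "norm (f x) \<le> max 1 B" for x
    using K(2)[of x] B by (cases "x \<in> K") auto
  then have "bounded (range f)" by (auto simp: bounded_iff)
  then show "f \<in> Cb" using f by (simp add: C0_def Cb_def)
qed

lemma Cb_subset_Bb: "Cb \<subseteq> Bb"
  by (auto simp: Cb_def Bb_def intro: borel_measurable_continuous_onI)

lemma Bb_integrable:
  assumes "prob_space M" "sets M = sets borel" "f \<in> Bb"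
  shows "integrable M f"
proof -
  interpret prob_space M by fact
  obtain B where "\<And>x. \<bar>f x\<bar> \<le> B" using assms(3) by (auto simp: Bb_def bounded_iff)
  then show ?thesis using assms
    by (intro integrable_const_bound[of _ B]) (auto simp: Bb_def cong: measurable_cong_sets)
qed

text \<open>\<open>C0_approx_compact\<close> and dominated convergence give equality on compact
  sets; inner regularity does the rest.\<close>

lemma measure_eqI_C0:
  fixes M N :: "'a::polish_space measure"
  assumes lc: "locally compact (UNIV :: 'a set)"
    and M: "prob_space M" "sets M = sets borel" and N: "prob_space N" "sets N = sets borel"
    and eq: "\<And>f. f \<in> C0 \<Longrightarrow> (\<integral>x. f x \<partial>M) = (\<integral>x. f x \<partial>N)"
  shows "M = N"
proof (rule measure_eqI)
  interpret M: prob_space M by fact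
  interpret N: prob_space N by fact
  have [simp]: "space M = UNIV" "space N = UNIV" using sets_eq_imp_space_eq[OF M(2)] sets_eq_imp_space_eq[OF N(2)] by simp_all
  have compact_eq: "measure M K = measure N K" if K: "compact K" for K
  proof -
    obtain f where f: "\<And>m::nat. f m \<in> C0" "\<And>m x. 0 \<le> f m x \<and> f m x \<le> (1::real)"
      "\<And>x. (\<lambda>m. f m x) \<longlonglongrightarrow> indicator K x"
      by (rule C0_approx_compact[OF lc K]) blast
    have fm: "f m \<in> borel_measurable borel" for m
      using f(1)[of m] C0_subset_Cb Cb_subset_Bb by (fastforce simp: Bb_def)
    have Kb: "K \<in> sets borel" using K by (simp add: compact_imp_closed)
    have "(\<lambda>m. \<integral>x. f m x \<partial>P) \<longlonglongrightarrow> (\<integral>x. indicator K x \<partial>P)"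
      if P: "prob_space P" "sets P = sets borel" for P
    proof -
      interpret P: prob_space P by fact
      show ?thesis
        using f fm P(2) Kb
        by (intro integral_dominated_convergence[where w="\<lambda>_. 1"])
           (auto cong: measurable_cong_sets)
    qed
    from this[OF M] this[OF N] eq[OF f(1)] have "(\<integral>x. indicator K x \<partial>M) = (\<integral>x. indicator K x \<partial>N :: real)"
      using LIMSEQ_unique by auto
    then show ?thesis using Kb M N by simp
  qed
  show "sets M = sets N" using M N by simp
  fix B assume "B \<in> sets M"
  then have B: "B \<in> sets borel" using M by simp
  have "emeasure M B = (SUP K \<in> {K. K \<subseteq> B \<and> compact K}. emeasure M K)"
    by (intro inner_regular M B) simp
  also have "\<dots> = (SUP K \<in> {K. K \<subseteq> B \<and> compact K}. emeasure N K)"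
    by (intro SUP_cong) (auto simp: compact_eq M.emeasure_eq_measure N.emeasure_eq_measure)
  also have "\<dots> = emeasure N B"
    by (intro inner_regular[symmetric] N B) simp
  finally show "emeasure M B = emeasure N B" .
qed

section \<open>\<open>L\<^sup>2\<close> and density of \<open>C\<^sub>0\<close>\<close>

lemma L2_measurable: "f \<in> L2 M \<Longrightarrow> f \<in> borel_measurable M"
  by (simp add: L2_def)

lemma L2_square_integrable: "f \<in> L2 M \<Longrightarrow> integrable M (\<lambda>x. (f x)\<^sup>2)"
  by (simp add: L2_def)

lemma L2_mult_integrable:
  assumes "f \<in> L2 M" "g \<in> L2 M"
  shows "integrable M (\<lambda>x. f x * g x)"
proof (rule Bochner_Integration.integrable_bound)
  show "integrable M (\<lambda>x. (f x)\<^sup>2 + (g x)\<^sup>2)"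
    using assms by (simp add: L2_square_integrable)
  show "(\<lambda>x. f x * g x) \<in> borel_measurable M"
    using assms by (simp add: L2_measurable borel_measurable_times)
  have "\<bar>a * b\<bar> \<le> a\<^sup>2 + b\<^sup>2" for a b :: real
    using sum_squares_bound[of "\<bar>a\<bar>" "\<bar>b\<bar>"] mult_nonneg_nonneg[OF abs_ge_zero[of a] abs_ge_zero[of b]]
    unfolding abs_mult power2_abs by linarith
  then show "AE x in M. norm (f x * g x) \<le> norm ((f x)\<^sup>2 + (g x)\<^sup>2)"
    by (auto intro!: AE_I2 simp: abs_of_nonneg)
qed

lemma L2_add: "f \<in> L2 M \<Longrightarrow> g \<in> L2 M \<Longrightarrow> (\<lambda>x. f x + g x) \<in> L2 M"
  using L2_mult_integrable[of f M g]
  by (auto simp: L2_def power2_sum mult.assoc)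

lemma L2_cmult: "f \<in> L2 M \<Longrightarrow> (\<lambda>x. c * f x) \<in> L2 M"
  by (auto simp: L2_def power_mult_distrib)

lemma L2_diff: "f \<in> L2 M \<Longrightarrow> g \<in> L2 M \<Longrightarrow> (\<lambda>x. f x - g x) \<in> L2 M"
  using L2_add[of f M "\<lambda>x. - 1 * g x"] L2_cmult[of g M "- 1"] by simp

lemma L2_sum: "finite I \<Longrightarrow> (\<And>i. i \<in> I \<Longrightarrow> f i \<in> L2 M) \<Longrightarrow> (\<lambda>x. \<Sum>i\<in>I. f i x) \<in> L2 M"
proof (induction I rule: finite_induct)
  case empty then show ?case by (simp add: L2_def)
next
  case (insert i I) then show ?case by (simp add: L2_add)
qed

lemma L2_bounded:
  assumes "finite_measure M" "f \<in> borel_measurable M" "\<And>x. \<bar>f x\<bar> \<le> B"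
  shows "f \<in> L2 M"
proof -
  interpret finite_measure M by fact
  have "norm ((f x)\<^sup>2) \<le> B\<^sup>2" for x
    using power_mono[OF assms(3) abs_ge_zero, of x 2] by simp
  then show ?thesis
    using assms(2) by (auto simp: L2_def intro!: integrable_const_bound[of _ "B\<^sup>2"])
qed

lemma L2_Bb:
  assumes "finite_measure M" "sets M = sets borel" "f \<in> Bb"
  shows "f \<in> L2 M"
proof -
  obtain B where "\<And>x. \<bar>f x\<bar> \<le> B" using assms(3) by (auto simp: Bb_def bounded_iff)
  then show ?thesis
    using assms by (intro L2_bounded[of _ _ B]) (auto simp: Bb_def cong: measurable_cong_sets)
qed

lemma L2_integrable: "finite_measure M \<Longrightarrow> f \<in> L2 M \<Longrightarrow> integrable M f"
  using L2_mult_integrable[of f M "\<lambda>_. 1"] L2_bounded[of M "\<lambda>_. 1" 1] by simp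

lemma L2_norm_square: "(L2_norm M f)\<^sup>2 = (\<integral>x. (f x)\<^sup>2 \<partial>M)"
  by (simp add: L2_norm_def L2_inner_def power2_eq_square[symmetric])

lemma L2_norm_nonneg: "0 \<le> L2_norm M f"
  by (simp add: L2_norm_def L2_inner_def)

lemma L2_norm_cmult: "L2_norm M (\<lambda>x. c * f x) = \<bar>c\<bar> * L2_norm M f"
proof -
  have "L2_inner M (\<lambda>x. c * f x) (\<lambda>x. c * f x) = c\<^sup>2 * L2_inner M f f"
    by (simp add: L2_inner_def power2_eq_square mult.assoc mult.left_commute)
  then show ?thesis by (simp add: L2_norm_def real_sqrt_mult)
qed

lemma L2_norm_diff_commute: "L2_norm M (\<lambda>x. f x - g x) = L2_norm M (\<lambda>x. g x - f x)"
  using L2_norm_cmult[of M "- 1" "\<lambda>x. f x - g x"] by simp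

lemma L2_norm_cong_AE:
  assumes "f \<in> borel_measurable M" "g \<in> borel_measurable M" "AE x in M. f x = g x"
  shows "L2_norm M f = L2_norm M g"
proof -
  have "L2_inner M f f = L2_inner M g g"
    unfolding L2_inner_def using assms by (intro integral_cong_AE) auto
  then show ?thesis by (simp add: L2_norm_def)
qed

lemma L2_norm_le_bound:
  assumes "prob_space M" "f \<in> borel_measurable M" "\<And>x. \<bar>f x\<bar> \<le> B"
  shows "L2_norm M f \<le> B"
proof -
  interpret prob_space M by fact
  have B: "0 \<le> B" using order_trans[OF abs_ge_zero assms(3)] .
  have sq: "(f x)\<^sup>2 \<le> B\<^sup>2" for x
    using power_mono[OF assms(3) abs_ge_zero, of x 2] by simp
  have "(L2_norm M f)\<^sup>2 \<le> (\<integral>x. B\<^sup>2 \<partial>M)"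
    unfolding L2_norm_square
    using sq L2_bounded[OF finite_measure_axioms assms(2,3)]
    by (intro integral_mono) (auto simp: L2_def)
  then show ?thesis
    using B by (simp add: prob_space power2_le_iff_abs_le L2_norm_nonneg)
qed

text \<open>The squared norm of \<open>f - t * g\<close> is a nonnegative quadratic in
  \<open>t\<close>, evaluated at its minimiser \<open>c / b\<close>. For \<open>b = 0\<close> it is
  affine, and its slope must vanish.\<close>

lemma L2_Cauchy_Schwarz:
  assumes f: "f \<in> L2 M" and g: "g \<in> L2 M"
  shows "\<bar>L2_inner M f g\<bar> \<le> L2_norm M f * L2_norm M g"
proof -
  define a b c where "a = L2_inner M f f" and "b = L2_inner M g g" and "c = L2_inner M f g"
  have ab: "0 \<le> a" "0 \<le> b" by (simp_all add: a_def b_def L2_inner_def)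
  note [simp] = L2_mult_integrable[OF f f] L2_mult_integrable[OF f g] L2_mult_integrable[OF g g]
  have quad: "0 \<le> a - 2 * t * c + t\<^sup>2 * b" for t
  proof -
    have "0 \<le> (\<integral>x. (f x - t * g x)\<^sup>2 \<partial>M)" by simp
    also have "\<dots> = (\<integral>x. f x * f x - 2 * t * (f x * g x) + t\<^sup>2 * (g x * g x) \<partial>M)"
      by (simp add: power2_eq_square algebra_simps)
    also have "\<dots> = a - 2 * t * c + t\<^sup>2 * b"
      by (simp add: a_def b_def c_def L2_inner_def)
    finally show ?thesis .
  qed
  have "c\<^sup>2 \<le> a * b"
  proof (cases "b = 0")
    case True
    have "c = 0"
    proof (rule ccontr)
      assume "c \<noteq> 0"
      \<comment> \<open>At this \<open>t\<close> the affine function takes the value -1.\<close>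
      with quad[of "(a + 1) / (2 * c)"] True show False by simp
    qed
    then show ?thesis using ab by simp
  next
    case False
    then show ?thesis
      using quad[of "c / b"] ab by (simp add: field_simps power2_eq_square)
  qed
  then have "sqrt (c\<^sup>2) \<le> sqrt (a * b)" by (rule real_sqrt_le_mono)
  then show ?thesis by (simp add: a_def b_def c_def L2_norm_def real_sqrt_mult)
qed

lemma L2_norm_triangle:
  assumes f: "f \<in> L2 M" and g: "g \<in> L2 M"
  shows "L2_norm M (\<lambda>x. f x + g x) \<le> L2_norm M f + L2_norm M g"
proof (rule power2_le_imp_le)
  note [simp] = L2_mult_integrable[OF f f] L2_mult_integrable[OF f g] L2_mult_integrable[OF g g]
    L2_square_integrable[OF f] L2_square_integrable[OF g]
  have "(L2_norm M (\<lambda>x. f x + g x))\<^sup>2 = (L2_norm M f)\<^sup>2 + (L2_norm M g)\<^sup>2 + 2 * L2_inner M f g"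
    unfolding L2_norm_square L2_inner_def by (simp add: power2_sum mult.assoc)
  also have "\<dots> \<le> (L2_norm M f + L2_norm M g)\<^sup>2"
    using L2_Cauchy_Schwarz[OF f g] by (simp add: power2_sum)
  finally show "(L2_norm M (\<lambda>x. f x + g x))\<^sup>2 \<le> (L2_norm M f + L2_norm M g)\<^sup>2" .
qed (simp add: L2_norm_nonneg)

lemma L2_norm_triangle_diff:
  assumes "f \<in> L2 M" "g \<in> L2 M" "h \<in> L2 M"
  shows "L2_norm M (\<lambda>x. f x - h x) \<le> L2_norm M (\<lambda>x. f x - g x) + L2_norm M (\<lambda>x. g x - h x)"
  using L2_norm_triangle[OF L2_diff[OF assms(1,2)] L2_diff[OF assms(2,3)]] by simp

lemma L2_norm_sum:
  assumes "finite I" "\<And>i. i \<in> I \<Longrightarrow> f i \<in> L2 M"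
  shows "L2_norm M (\<lambda>x. \<Sum>i\<in>I. f i x) \<le> (\<Sum>i\<in>I. L2_norm M (f i))"
  using assms
proof (induction I rule: finite_induct)
  case empty then show ?case by (simp add: L2_norm_def L2_inner_def)
next
  case (insert i I)
  then show ?case
    using L2_norm_triangle[of "f i" M "\<lambda>x. \<Sum>i\<in>I. f i x"] L2_sum[of I f M] by fastforce
qed

lemma L2_norm_tendsto_0_dominated:
  fixes f :: "nat \<Rightarrow> 'a \<Rightarrow> real"
  assumes "integrable M (\<lambda>x. (w x)\<^sup>2)" "\<And>m. f m \<in> borel_measurable M" "g \<in> borel_measurable M"
    and "\<And>x. (\<lambda>m. f m x) \<longlonglongrightarrow> g x" and "\<And>m x. \<bar>f m x - g x\<bar> \<le> w x"
  shows "(\<lambda>m. L2_norm M (\<lambda>x. f m x - g x)) \<longlonglongrightarrow> 0"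
proof -
  have "(\<lambda>m. \<integral>x. (f m x - g x)\<^sup>2 \<partial>M) \<longlonglongrightarrow> (\<integral>x. 0 \<partial>M)"
  proof (rule integral_dominated_convergence[where w="\<lambda>x. (w x)\<^sup>2"])
    show "AE x in M. (\<lambda>m. (f m x - g x)\<^sup>2) \<longlonglongrightarrow> 0"
    proof (rule AE_I2)
      fix x
      show "(\<lambda>m. (f m x - g x)\<^sup>2) \<longlonglongrightarrow> 0"
        using tendsto_power[OF LIM_zero[OF assms(4)[of x]], of 2] by simp
    qed
    fix m
    have "(f m x - g x)\<^sup>2 \<le> (w x)\<^sup>2" for x
      using power_mono[OF assms(5)[of m x] abs_ge_zero, of 2] by simp
    then show "AE x in M. norm ((f m x - g x)\<^sup>2) \<le> (w x)\<^sup>2" by simp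
  qed (use assms in auto)
  then have "(\<lambda>m. sqrt (\<integral>x. (f m x - g x)\<^sup>2 \<partial>M)) \<longlonglongrightarrow> sqrt 0"
    by (intro tendsto_real_sqrt) simp
  then show ?thesis by (simp add: L2_norm_def L2_inner_def power2_eq_square)
qed

section \<open>Density of \<open>C0\<close> in L2\<close>

lemma C0_vanish: "f \<in> C0 \<Longrightarrow> e > 0 \<Longrightarrow> \<exists>K. compact K \<and> (\<forall>x. x \<notin> K \<longrightarrow> \<bar>f x\<bar> < e)"
  by (simp add: C0_def)

lemma C0_add: "f \<in> C0 \<Longrightarrow> g \<in> C0 \<Longrightarrow> (\<lambda>x. f x + g x) \<in> (C0 :: ('b::topological_space \<Rightarrow> real) set)"
proof -
  assume f: "f \<in> C0" and g: "g \<in> C0"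
  have "\<exists>K. compact K \<and> (\<forall>x. x \<notin> K \<longrightarrow> \<bar>f x + g x\<bar> < e)" if e: "e > 0" for e
  proof -
    obtain K where K: "compact K" "\<forall>x. x \<notin> K \<longrightarrow> \<bar>f x\<bar> < e / 2"
      using C0_vanish[OF f, of "e / 2"] e by auto
    obtain L where L: "compact L" "\<forall>x. x \<notin> L \<longrightarrow> \<bar>g x\<bar> < e / 2"
      using C0_vanish[OF g, of "e / 2"] e by auto
    have "\<bar>f x + g x\<bar> < e" if "x \<notin> K \<union> L" for x
      using K(2)[rule_format, of x] L(2)[rule_format, of x] that by auto
    then show ?thesis using K(1) L(1) by (intro exI[of _ "K \<union> L"]) auto
  qed
  then show ?thesis using f g by (auto simp: C0_def intro: continuous_on_add)
qed

lemma C0_cmult: "f \<in> C0 \<Longrightarrow> (\<lambda>x. c * f x) \<in> (C0 :: ('b::topological_space \<Rightarrow> real) set)"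
proof -
  assume f: "f \<in> C0"
  have "\<exists>K. compact K \<and> (\<forall>x. x \<notin> K \<longrightarrow> \<bar>c * f x\<bar> < e)" if e: "e > 0" for e
  proof (cases "c = 0")
    case True then show ?thesis using that by (intro exI[of _ "{}"]) auto
  next
    case False
    obtain K where K: "compact K" "\<forall>x. x \<notin> K \<longrightarrow> \<bar>f x\<bar> < e / \<bar>c\<bar>"
      using C0_vanish[OF f, of "e / \<bar>c\<bar>"] e False by auto
    then show ?thesis using False by (intro exI[of _ K]) (auto simp: abs_mult field_simps)
  qed
  then show ?thesis using f by (auto simp: C0_def intro: continuous_on_mult_left)
qed

text \<open>The predicate \<open>appr\<close> is closed under sums, multiples and L2 limits. It
  holds for indicators of compact sets by \<open>C0_approx_compact\<close>, for Borel indicators by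
  inner regularity, for nonnegative functions by monotone approximation, and for \<open>f\<close> by
  splitting into positive and negative part.\<close>

lemma C0_dense_L2:
  fixes M :: "'a::polish_space measure"
  assumes lc: "locally compact (UNIV :: 'a set)"
    and M: "prob_space M" "sets M = sets borel" and f: "f \<in> L2 M" and e: "e > 0"
  shows "\<exists>g\<in>C0. L2_norm M (\<lambda>x. f x - g x) < e"
proof -
  interpret prob_space M by fact
  have [simp]: "space M = UNIV" using sets_eq_imp_space_eq[OF M(2)] by simp
  note fin = finite_measure_axioms
  note [measurable_cong] = M(2)
  define appr where "appr f \<longleftrightarrow> (\<forall>e>0. \<exists>g\<in>C0. L2_norm M (\<lambda>x. f x - g x) < e)" for f
  have apprD: "\<exists>g\<in>C0. L2_norm M (\<lambda>x. f x - g x) < e" if "appr f" "e > 0" for f e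
    using that by (simp add: appr_def)
  have C0_L2: "g \<in> L2 M" if "g \<in> C0" for g
    using that C0_subset_Cb Cb_subset_Bb by (intro L2_Bb fin M) blast
  have appr_add: "appr (\<lambda>x. f x + g x)" if fg: "appr f" "appr g" and fg2: "f \<in> L2 M" "g \<in> L2 M" for f g
    unfolding appr_def
  proof (intro allI impI)
    fix e :: real assume "e > 0"
    then obtain f' g' where "f' \<in> C0" "L2_norm M (\<lambda>x. f x - f' x) < e / 2"
      "g' \<in> C0" "L2_norm M (\<lambda>x. g x - g' x) < e / 2"
      using apprD[OF fg(1), of "e / 2"] apprD[OF fg(2), of "e / 2"] by auto
    then show "\<exists>h\<in>C0. L2_norm M (\<lambda>x. f x + g x - h x) < e"
      using L2_norm_triangle[OF L2_diff[OF fg2(1) C0_L2[of f']] L2_diff[OF fg2(2) C0_L2[of g']]]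
      by (intro bexI[OF _ C0_add[of f' g']]) (auto simp: algebra_simps)
  qed
  have appr_cmult: "appr (\<lambda>x. c * f x)" if f: "appr f" for f c
    unfolding appr_def
  proof (intro allI impI)
    fix e :: real assume "e > 0"
    \<comment> \<open>The summand 1 in the denominator covers \<open>c = 0\<close>.\<close>
    then obtain f' where f': "f' \<in> C0" "L2_norm M (\<lambda>x. f x - f' x) < e / (\<bar>c\<bar> + 1)"
      using apprD[OF f, of "e / (\<bar>c\<bar> + 1)"] by (auto simp: add_nonneg_pos)
    have "L2_norm M (\<lambda>x. c * f x - c * f' x) = \<bar>c\<bar> * L2_norm M (\<lambda>x. f x - f' x)"
      using L2_norm_cmult[of M c "\<lambda>x. f x - f' x"] by (simp add: right_diff_distrib)
    also have "\<dots> \<le> (\<bar>c\<bar> + 1) * L2_norm M (\<lambda>x. f x - f' x)"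
      by (intro mult_right_mono) (auto simp: L2_norm_nonneg)
    also have "\<dots> < e" using f'(2) by (simp add: field_simps)
    finally show "\<exists>h\<in>C0. L2_norm M (\<lambda>x. c * f x - h x) < e"
      using C0_cmult[OF f'(1), of c] by (intro bexI[of _ "\<lambda>x. c * f' x"])
  qed
  have appr_lim: "appr f"
    if F: "\<And>m::nat. appr (F m)" "\<And>m. F m \<in> L2 M" and f: "f \<in> L2 M"
      and lim: "(\<lambda>m. L2_norm M (\<lambda>x. F m x - f x)) \<longlonglongrightarrow> 0" for F f
    unfolding appr_def
  proof (intro allI impI)
    fix e :: real assume e: "e > 0"
    obtain m where m: "L2_norm M (\<lambda>x. F m x - f x) < e / 2"
      using order_tendstoD(2)[OF lim, of "e / 2"] e by (auto simp: eventually_sequentially)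
    obtain g where g: "g \<in> C0" "L2_norm M (\<lambda>x. F m x - g x) < e / 2"
      using apprD[OF F(1)[of m], of "e / 2"] e by auto
    have "L2_norm M (\<lambda>x. f x - g x) < e"
      using L2_norm_triangle_diff[OF f F(2)[of m] C0_L2[OF g(1)]] m g(2)
        L2_norm_diff_commute[of M f "F m"] by simp
    then show "\<exists>g\<in>C0. L2_norm M (\<lambda>x. f x - g x) < e"
      using g(1) by (intro bexI[of _ g])
  qed
  have ind_L2: "(indicator B :: 'a \<Rightarrow> real) \<in> L2 M" if "B \<in> sets borel" for B
    using that by (intro L2_bounded[OF fin, of _ 1]) (auto simp: indicator_def)
  have appr_compact: "appr (indicator K)" if K: "compact K" for K
  proof -
    obtain h where h: "\<And>m::nat. h m \<in> C0" "\<And>m x. 0 \<le> h m x \<and> h m x \<le> (1::real)"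
      "\<And>x. (\<lambda>m. h m x) \<longlonglongrightarrow> indicator K x"
      by (rule C0_approx_compact[OF lc K]) blast
    have Kb: "K \<in> sets borel" using K by (simp add: compact_imp_closed)
    show ?thesis
    proof (rule appr_lim[of h])
      show "appr (h m)" for m
        unfolding appr_def using h(1)[of m]
        by (intro allI impI bexI[of _ "h m"]) (simp_all add: L2_norm_def L2_inner_def)
      show "(\<lambda>m. L2_norm M (\<lambda>x. h m x - indicator K x)) \<longlonglongrightarrow> 0"
      proof (rule L2_norm_tendsto_0_dominated[where w="\<lambda>_. 1"])
        show "\<bar>h m x - indicator K x\<bar> \<le> 1" for m x
          using h(2)[of m x] by (auto simp: indicator_def)
      qed (use h(3) Kb C0_L2[OF h(1)] in \<open>auto simp: L2_measurable\<close>)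
    qed (use C0_L2[OF h(1)] ind_L2[OF Kb] in auto)
  qed
  have appr_ind: "appr (indicator B)" if B: "B \<in> sets borel" for B
  proof -
    have "\<exists>K. K \<subseteq> B \<and> compact K \<and> measure M B - 1 / real (Suc m) < measure M K" for m
    proof -
      have "emeasure M B = (SUP K \<in> {K. K \<subseteq> B \<and> compact K}. emeasure M K)"
        by (intro inner_regular M B) simp
      show ?thesis
      \<comment> \<open>\<open>ennreal\<close> truncates negative numbers to 0, so the supremum
        argument wants a nonnegative bound; for a negative one the empty set already works.\<close>
      proof (cases "measure M B - 1 / real (Suc m) < 0")
        case True
        then show ?thesis by (intro exI[of _ "{}"]) auto
      next
        case False
        moreover have "0 < 1 / real (Suc m)" by simp
        ultimately have "0 < measure M B" by linarith
        then have "ennreal (measure M B - 1 / real (Suc m)) < emeasure M B"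
          by (auto simp: emeasure_eq_measure intro!: ennreal_lessI)
        also have "emeasure M B = (SUP K \<in> {K. K \<subseteq> B \<and> compact K}. emeasure M K)"
          by fact
        finally obtain K where "K \<subseteq> B" "compact K" "ennreal (measure M B - 1 / real (Suc m)) < emeasure M K"
          by (auto simp: less_SUP_iff)
        then show ?thesis using False
          by (intro exI[of _ K]) (auto simp: emeasure_eq_measure ennreal_less_iff)
      qed
    qed
    then obtain K where K: "\<And>m. K m \<subseteq> B" "\<And>m. compact (K m)"
      "\<And>m. measure M B - 1 / real (Suc m) < measure M (K m)" by metis
    have Kb: "K m \<in> sets borel" for m using K(2) by (simp add: compact_imp_closed)
    have norm_eq: "L2_norm M (\<lambda>x. indicator (K m) x - indicator B x) = sqrt (measure M B - measure M (K m))" for m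
    proof -
      have "(indicator (K m) x - indicator B x) * (indicator (K m) x - indicator B x)
          = (indicator (B - K m) x :: real)" for x
        using K(1)[of m] by (auto simp: indicator_def)
      then have "L2_norm M (\<lambda>x. indicator (K m) x - indicator B x) = sqrt (measure M (B - K m))"
        unfolding L2_norm_def L2_inner_def using B Kb[of m] M(2) by simp
      then show ?thesis using finite_measure_Diff[of B "K m"] K(1)[of m] Kb[of m] B M(2) by simp
    qed
    have "(\<lambda>m. measure M B - measure M (K m)) \<longlonglongrightarrow> 0"
    proof (rule real_tendsto_sandwich[where f="\<lambda>_. 0" and h="\<lambda>m. 1 / real (Suc m)"])
      show "\<forall>\<^sub>F m in sequentially. 0 \<le> measure M B - measure M (K m)"
        using K(1) B M(2) by (auto intro!: always_eventually finite_measure_mono)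
      show "\<forall>\<^sub>F m in sequentially. measure M B - measure M (K m) \<le> 1 / real (Suc m)"
        using K(3) by (intro always_eventually allI) (simp add: less_imp_le algebra_simps less_diff_eq)
    qed (use LIMSEQ_inverse_real_of_nat in \<open>auto simp: inverse_eq_divide\<close>)
    then have "(\<lambda>m. L2_norm M (\<lambda>x. indicator (K m) x - indicator B x)) \<longlonglongrightarrow> 0"
      unfolding norm_eq using tendsto_real_sqrt by fastforce
    then show ?thesis
      by (rule appr_lim[rotated 3]) (use appr_compact K(2) ind_L2 Kb B in auto)
  qed
  \<comment> \<open>The induction runs through all nonnegative Borel functions, so membership in
    \<open>L2\<close> is part of the induction formula; the steps recover it for the smaller
    functions by rescaling or domination.\<close>
  have appr_nonneg: "u \<in> L2 M \<longrightarrow> appr u" if "u \<in> borel_measurable borel" "\<And>x. 0 \<le> u x" for u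
    using that
  proof (induction u rule: borel_measurable_induct_real)
    case (set A) then show ?case by (simp add: appr_ind)
  next
    case (mult u c)
    show ?case
    \<comment> \<open>For \<open>c = 0\<close> the function \<open>u\<close> may lie outside
      \<open>L2\<close>, so the induction hypothesis is out of reach; the zero function is treated
      as a multiple of an indicator.\<close>
    proof (cases "c = 0")
      case True
      show ?thesis using True appr_cmult[OF appr_ind[of "{}"], of 0] by simp
    next
      case False
      then show ?thesis using mult.IH appr_cmult[of u c] L2_cmult[of "\<lambda>x. c * u x" M "1 / c"] by auto
    qed
  next
    case (add u v)
    show ?case
    proof
      assume S: "(\<lambda>x. v x + u x) \<in> L2 M"
      \<comment> \<open>Both summands lie between 0 and the sum, hence inherit its square
        integrability.\<close>
      have "w \<in> L2 M" if "w \<in> borel_measurable borel" "\<And>x. 0 \<le> w x \<and> w x \<le> v x + u x" for w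
      proof -
        have "(w x)\<^sup>2 \<le> (v x + u x)\<^sup>2" for x using that(2)[of x] by (intro power_mono) auto
        then have "integrable M (\<lambda>x. (w x)\<^sup>2)"
          using that(1) L2_square_integrable[OF S] by (elim Bochner_Integration.integrable_bound) auto
        then show ?thesis using that(1) by (simp add: L2_def)
      qed
      from this[of u] this[of v] add show "appr (\<lambda>x. v x + u x)"
        by (intro appr_add) auto
    qed
  next
    case (seq U)
    show ?case
    proof
      assume u: "u \<in> L2 M"
      have lim: "(\<lambda>m. U m x) \<longlonglongrightarrow> u x" for x using seq.hyps(4) by simp
      have Ule: "U m x \<le> u x" for m x
      proof (rule incseq_le[OF _ lim])
        show "incseq (\<lambda>i. U i x)" using seq.hyps(3) by (auto simp: incseq_def le_fun_def)
      qed
      have U_L2: "U m \<in> L2 M" for m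
      proof -
        have "(U m x)\<^sup>2 \<le> (u x)\<^sup>2" for x using seq.hyps(2) Ule by (intro power_mono) auto
        then have "integrable M (\<lambda>x. (U m x)\<^sup>2)"
          using seq.hyps(1) L2_square_integrable[OF u] by (elim Bochner_Integration.integrable_bound) auto
        then show ?thesis using seq.hyps(1) by (simp add: L2_def)
      qed
      have "(\<lambda>m. L2_norm M (\<lambda>x. U m x - u x)) \<longlonglongrightarrow> 0"
      proof (rule L2_norm_tendsto_0_dominated[where w=u])
        show "\<bar>U m x - u x\<bar> \<le> u x" for m x
          using Ule[of m x] seq.hyps(2)[of m x] by auto
      qed (use lim seq.hyps(1) u in \<open>auto simp: L2_def\<close>)
      then show "appr u" by (rule appr_lim[OF mp[OF seq.IH U_L2] U_L2 u])
    qed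
  qed
  have "f \<in> borel_measurable borel" using L2_measurable[OF f] M(2) by (simp cong: measurable_cong_sets)
  moreover have max_L2: "(\<lambda>x. max 0 (g x)) \<in> L2 M" if "g \<in> L2 M" for g
  proof -
    have "(max 0 (g x))\<^sup>2 \<le> (g x)\<^sup>2" for x by (auto simp: max_def)
    then have "integrable M (\<lambda>x. (max 0 (g x))\<^sup>2)"
      using that L2_square_integrable[OF that] by (elim Bochner_Integration.integrable_bound) (auto simp: L2_def)
    then show ?thesis using L2_measurable[OF that] by (simp add: L2_def)
  qed
  moreover have "(\<lambda>x. - f x) \<in> L2 M" using L2_cmult[OF f, of "- 1"] by simp
  ultimately have *: "appr (\<lambda>x. max 0 (f x) + - 1 * max 0 (- f x))"
    using f by (intro appr_add appr_cmult L2_cmult max_L2 appr_nonneg[rule_format]) auto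
  have "(\<lambda>x. max 0 (f x) + - 1 * max 0 (- f x)) = f" by (auto simp: max_def)
  from apprD[OF *[unfolded this] e] show ?thesis .
qed

section \<open>Feller semigroups on \<open>C\<^sub>0\<close>\<close>

text \<open>Completeness gives continuous curves such as the orbits of the semigroup an integral
  with values in this space.\<close>

instance bcontfun :: (metric_space, banach) banach ..

text \<open>Riemann sums over fine tagged divisions lie in \<open>V\<close>, and \<open>V\<close> is
  closed. This keeps time integrals of the semigroup in \<open>C0_space\<close>.\<close>

lemma integral_in_closed_subspace:
  fixes f :: "real \<Rightarrow> 'b::banach"
  assumes "continuous_on {a..b} f" "closed V" "subspace V" "\<And>x. x \<in> {a..b} \<Longrightarrow> f x \<in> V"
  shows "integral {a..b} f \<in> V"
proof -
  have hi: "(f has_integral integral {a..b} f) (cbox a b)"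
    using integrable_continuous_real[OF assms(1)] by (simp add: has_integral_integral)
  have "\<exists>y\<in>V. dist y (integral {a..b} f) < e" if e: "e > 0" for e
  proof -
    from hi[unfolded has_integral, rule_format, OF e] obtain \<gamma> where \<gamma>: "gauge \<gamma>"
      "\<forall>\<D>. \<D> tagged_division_of (cbox a b) \<and> \<gamma> fine \<D> \<longrightarrow>
        norm ((\<Sum>(x, k)\<in>\<D>. measure lborel k *\<^sub>R f x) - integral {a..b} f) < e"
      by (elim exE conjE) (rule that)
    obtain \<D> where D: "\<D> tagged_division_of (cbox a b)" "\<gamma> fine \<D>"
      using fine_division_exists[OF \<gamma>(1)] by blast
    have "(\<Sum>(x, k)\<in>\<D>. measure lborel k *\<^sub>R f x) \<in> V"
    proof (rule subspace_sum[OF assms(3)])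
      fix z assume z: "z \<in> \<D>"
      obtain x k where "z = (x, k)" by (cases z)
      moreover have "x \<in> {a..b}"
        using tagged_division_ofD(2,3)[OF D(1)] z \<open>z = (x, k)\<close> by (metis box_real(2) subsetD)
      ultimately show "(case z of (x, k) \<Rightarrow> measure lborel k *\<^sub>R f x) \<in> V"
        using assms(3,4) by (simp add: subspace_scale)
    qed
    with \<gamma>(2)[rule_format, OF conjI[OF D]] show ?thesis by (auto simp: dist_norm)
  qed
  then have "integral {a..b} f \<in> closure V" by (auto simp: closure_approachable)
  then show ?thesis using assms(2) by simp
qed

lemma bcontfun_Bb: "apply_bcontfun f \<in> Bb"
  using Cb_subset_Bb by (auto simp: Cb_def)

lemma abs_apply_bcontfun_le: "\<bar>apply_bcontfun f x\<bar> \<le> norm f"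
  using norm_bounded[of f x] by simp

text \<open>Allows integration against a probability measure to be exchanged with limits,
  derivatives and time integrals taken in sup norm.\<close>

lemma bounded_linear_integral_bcontfun:
  fixes M :: "'a::topological_space measure"
  assumes "prob_space M" "sets M = sets borel"
  shows "bounded_linear (\<lambda>f :: 'a \<Rightarrow>\<^sub>C real. \<integral>x. f x \<partial>M)"
proof -
  interpret prob_space M by fact
  note int = Bb_integrable[OF assms bcontfun_Bb]
  show ?thesis
  proof (rule bounded_linear_intro[where K=1])
    fix f :: "'a \<Rightarrow>\<^sub>C real"
    have "norm (\<integral>x. f x \<partial>M) \<le> (\<integral>x. norm (f x) \<partial>M)" by (rule integral_norm_bound)
    also have "\<dots> \<le> (\<integral>x. norm f \<partial>M)"
      using int by (intro integral_mono) (auto simp: abs_apply_bcontfun_le)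
    finally show "norm (\<integral>x. f x \<partial>M) \<le> norm f * 1" by (simp add: prob_space)
  qed (use int in simp_all)
qed

lemma bounded_linear_apply_bcontfun:
  "bounded_linear (\<lambda>f :: 'a::topological_space \<Rightarrow>\<^sub>C real. f x)"
  by (rule bounded_linear_intro[where K=1]) (auto simp: abs_apply_bcontfun_le)

text \<open>The transition kernel. As a measure-valued map it can be composed with an initial
  measure by \<open>bind\<close>, which turns invariance into an equation between measures.\<close>

definition kernel :: "('b::topological_space, 'w) process \<Rightarrow> real \<Rightarrow> 'b \<Rightarrow> 'b measure" where
  "kernel Z t x = distr (law_from Z x) borel (state Z t)"

text \<open>Kept as a subset of the Banach space of bounded continuous functions: centring by a
  nonzero constant leaves \<open>C0_space\<close> unless the state space is compact, but not the
  ambient space.\<close>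

definition C0_space :: "('b::metric_space \<Rightarrow>\<^sub>C real) set" where
  "C0_space = {f. apply_bcontfun f \<in> C0}"

text \<open>Meaningful for \<open>0 \<le> t\<close> and \<open>f \<in> C0_space\<close>, where the
  image is bounded and continuous (\<open>apply_T\<close>). Elsewhere \<open>Bcontfun\<close> may be
  applied to a function that is neither, so \<open>T t\<close> is not known to be linear on the
  whole type.\<close>

definition semigroup_bcontfun ::
    "('b::metric_space, 'w) process \<Rightarrow> real \<Rightarrow> ('b \<Rightarrow>\<^sub>C real) \<Rightarrow> ('b \<Rightarrow>\<^sub>C real)" where
  "semigroup_bcontfun Z t f = Bcontfun (semigroup_of Z t (apply_bcontfun f))"

lemma C0_bcontfunE:
  fixes f :: "'b::metric_space \<Rightarrow> real"
  assumes "f \<in> C0"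
  obtains F :: "'b \<Rightarrow>\<^sub>C real" where "f = apply_bcontfun F" "F \<in> C0_space"
proof -
  have "f \<in> bcontfun" using assms C0_subset_Cb by (auto simp: Cb_def bcontfun_def)
  then obtain F where "f = apply_bcontfun F" by (rule bcontfunE)
  with assms that show thesis by (simp add: C0_space_def)
qed

lemma subspace_C0_space: "subspace C0_space"
  by (auto simp: subspace_def C0_space_def C0_add C0_cmult)
     (auto simp: C0_def intro!: exI[of _ "{}"])

lemma closed_C0_space: "closed (C0_space :: ('b::metric_space \<Rightarrow>\<^sub>C real) set)"
proof -
  have "f \<in> C0_space" if f: "f \<in> closure C0_space" for f :: "'b \<Rightarrow>\<^sub>C real"
  proof -
    have "\<exists>K. compact K \<and> (\<forall>x. x \<notin> K \<longrightarrow> \<bar>f x\<bar> < e)" if e: "e > 0" for e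
    proof -
      obtain g where g: "g \<in> C0_space" "dist g f < e / 2"
        using f e unfolding closure_approachable by (meson half_gt_zero)
      then obtain K where K: "compact K" "\<forall>x. x \<notin> K \<longrightarrow> \<bar>g x\<bar> < e / 2"
        using C0_vanish[of "apply_bcontfun g" "e / 2"] e unfolding C0_space_def by auto
      have "\<bar>f x\<bar> < e" if "x \<notin> K" for x
        using K(2)[rule_format, OF that] dist_fun_lt_imp_dist_val_lt[OF g(2), of x]
        unfolding dist_real_def by linarith
      with K(1) show ?thesis by blast
    qed
    then show ?thesis by (simp add: C0_space_def C0_def)
  qed
  then show ?thesis by (metis closure_subset closure_eq subsetI subset_antisym)
qed

locale feller =
  fixes Z :: "('b::polish_space, 'w) process"
  assumes markov: "markov_process Z"
    and semigroup_C0: "\<And>t f. 0 \<le> t \<Longrightarrow> f \<in> C0 \<Longrightarrow> semigroup_of Z t f \<in> C0"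
    and strongly_continuous: "\<And>f. f \<in> C0 \<Longrightarrow> uniform_limit UNIV (\<lambda>t. semigroup_of Z t f) f (at_right 0)"
begin

abbreviation "S \<equiv> semigroup_of Z"
abbreviation "T \<equiv> semigroup_bcontfun Z"

section \<open>Transition kernels and the semigroup on bounded Borel functions\<close>

lemma law: "prob_space (law_from Z x)" "sets (law_from Z x) = sets (sample_space Z)"
proof -
  have "law_from Z \<in> borel \<rightarrow>\<^sub>M prob_algebra (sample_space Z)"
    using markov by (simp add: markov_process_def)
  from measurable_space[OF this, of x] show "prob_space (law_from Z x)" "sets (law_from Z x) = sets (sample_space Z)"
    by (auto simp: space_prob_algebra)
qed

lemma state_measurable: "0 \<le> t \<Longrightarrow> state Z t \<in> law_from Z x \<rightarrow>\<^sub>M borel"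
  using markov law(2)[of x] by (simp add: markov_process_def cong: measurable_cong_sets)

lemma kernel_measurable: "0 \<le> t \<Longrightarrow> kernel Z t \<in> borel \<rightarrow>\<^sub>M prob_algebra borel"
  unfolding kernel_def
  using markov by (intro measurable_compose[OF _ measurable_distr_prob_space]) (auto simp: markov_process_def)

lemma kernel_measurable_subprob: "0 \<le> t \<Longrightarrow> kernel Z t \<in> borel \<rightarrow>\<^sub>M subprob_algebra borel"
  by (intro measurable_prob_algebraD kernel_measurable)

lemma prob_kernel: "0 \<le> t \<Longrightarrow> prob_space (kernel Z t x)"
  unfolding kernel_def by (intro prob_space.prob_space_distr law state_measurable)

lemma sets_kernel: "sets (kernel Z t x) = sets borel"
  by (simp add: kernel_def)

lemma semigroup_kernel:
  "0 \<le> t \<Longrightarrow> f \<in> borel_measurable borel \<Longrightarrow> S t f x = (\<integral>y. f y \<partial>kernel Z t x)"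
  by (simp add: semigroup_of_def kernel_def integral_distr state_measurable)

lemma semigroup_measurable:
  assumes "0 \<le> t" "f \<in> borel_measurable borel"
  shows "S t f \<in> borel_measurable borel"
proof -
  have "(\<lambda>x. \<integral>y. f y \<partial>kernel Z t x) \<in> borel_measurable borel"
    using kernel_measurable_subprob[OF assms(1)] integral_measurable_subprob_algebra[OF assms(2)]
    by (rule measurable_compose)
  then show ?thesis using semigroup_kernel[OF assms] by (simp cong: measurable_cong)
qed

lemma kernel_integrable: "0 \<le> t \<Longrightarrow> f \<in> Bb \<Longrightarrow> integrable (kernel Z t x) f"
  by (intro Bb_integrable prob_kernel sets_kernel)

lemma semigroup_bound:
  assumes "0 \<le> t" "f \<in> borel_measurable borel" "\<And>x. \<bar>f x\<bar> \<le> B"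
  shows "\<bar>S t f x\<bar> \<le> B"
proof -
  interpret prob_space "kernel Z t x" by (rule prob_kernel) fact
  have "f \<in> Bb" using assms by (auto simp: Bb_def bounded_iff)
  note int = kernel_integrable[OF assms(1) this, of x]
  have "\<bar>\<integral>y. f y \<partial>kernel Z t x\<bar> \<le> (\<integral>y. \<bar>f y\<bar> \<partial>kernel Z t x)"
    using integral_norm_bound[of "kernel Z t x" f] by simp
  also have "\<dots> \<le> (\<integral>y. B \<partial>kernel Z t x)"
    using int assms(3) by (intro integral_mono) auto
  finally show ?thesis by (simp add: semigroup_kernel[OF assms(1,2)] prob_space)
qed

lemma semigroup_zero:
  assumes "f \<in> borel_measurable borel"
  shows "S 0 f = f"
proof
  fix x
  interpret prob_space "law_from Z x" by (rule law)
  have "AE \<omega> in law_from Z x. state Z 0 \<omega> = x"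
    using markov by (simp add: markov_process_def)
  then have "(\<integral>\<omega>. f (state Z 0 \<omega>) \<partial>law_from Z x) = (\<integral>\<omega>. f x \<partial>law_from Z x)"
    using assms state_measurable[of 0 x] by (intro integral_cong_AE) auto
  then show "S 0 f x = f x" by (simp add: semigroup_of_def prob_space)
qed

text \<open>Chapman-Kolmogorov: conditioning on the past up to \<open>s\<close> does not change the
  integral, and by the Markov property the conditional expectation is almost surely
  \<open>S t f (state Z s \<omega>)\<close>.\<close>

lemma semigroup_add:
  assumes "0 \<le> s" "0 \<le> t" "f \<in> Bb"
  shows "S (s + t) f = S s (S t f)"
proof
  fix x
  interpret prob_space "law_from Z x" by (rule law)
  have sub: "subalgebra (law_from Z x) (natural_filtration Z s)"
    unfolding subalgebra_def
  proof
    have gen: "{state Z u -` A \<inter> space (sample_space Z) |u A. 0 \<le> u \<and> u \<le> s \<and> A \<in> sets borel}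
        \<subseteq> sets (sample_space Z)"
      using markov by (auto simp: markov_process_def intro: measurable_sets)
    show "space (natural_filtration Z s) = space (law_from Z x)"
      using sets_eq_imp_space_eq[OF law(2)] unfolding natural_filtration_def by (simp add: space_measure_of_conv)
    show "sets (natural_filtration Z s) \<subseteq> sets (law_from Z x)"
      unfolding natural_filtration_def law(2)
      using gen by (subst sets_measure_of) (auto intro!: sets.sigma_sets_subset)
  qed
  interpret finite_measure_subalgebra "law_from Z x" "natural_filtration Z s"
    by unfold_locales (rule sub)
  have fm: "f \<in> borel_measurable borel" using assms(3) by (simp add: Bb_def)
  obtain B where B: "\<And>x. \<bar>f x\<bar> \<le> B" using assms(3) by (auto simp: Bb_def bounded_iff)
  have [measurable]: "(\<lambda>\<omega>. f (state Z (s + t) \<omega>)) \<in> borel_measurable (law_from Z x)"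
    using assms by (intro measurable_compose[OF state_measurable fm]) auto
  have int: "integrable (law_from Z x) (\<lambda>\<omega>. f (state Z (s + t) \<omega>))"
    using B by (intro integrable_const_bound[of _ B]) auto
  have "S (s + t) f x = (\<integral>\<omega>. real_cond_exp (law_from Z x) (natural_filtration Z s) (\<lambda>\<omega>. f (state Z (s + t) \<omega>)) \<omega> \<partial>law_from Z x)"
    using real_cond_exp_int(2)[OF int] by (simp add: semigroup_of_def)
  also have "\<dots> = (\<integral>\<omega>. S t f (state Z s \<omega>) \<partial>law_from Z x)"
  proof (rule integral_cong_AE)
    show "AE \<omega> in law_from Z x. real_cond_exp (law_from Z x) (natural_filtration Z s)
        (\<lambda>\<omega>. f (state Z (s + t) \<omega>)) \<omega> = S t f (state Z s \<omega>)"
      using markov assms by (simp add: markov_process_def)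
    show "(\<lambda>\<omega>. S t f (state Z s \<omega>)) \<in> borel_measurable (law_from Z x)"
      using assms fm by (intro measurable_compose[OF state_measurable semigroup_measurable]) auto
  qed simp
  finally show "S (s + t) f x = S s (S t f) x" by (simp add: semigroup_of_def)
qed

lemma semigroup_lincomb:
  assumes "0 \<le> t" "f \<in> Bb" "g \<in> Bb"
  shows "S t (\<lambda>x. a * f x + b * g x) = (\<lambda>x. a * S t f x + b * S t g x)"
proof
  fix x
  have "(\<lambda>x. a * f x + b * g x) \<in> borel_measurable borel"
    using assms by (auto simp: Bb_def)
  then show "S t (\<lambda>x. a * f x + b * g x) x = a * S t f x + b * S t g x"
    using assms kernel_integrable[OF assms(1,2), of x] kernel_integrable[OF assms(1,3), of x]
    by (simp add: semigroup_kernel Bb_def)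
qed

section \<open>The semigroup as contractions of \<open>C0_space\<close>, and its generator\<close>

lemma apply_T: "0 \<le> t \<Longrightarrow> f \<in> C0_space \<Longrightarrow> apply_bcontfun (T t f) = S t f"
  unfolding semigroup_bcontfun_def C0_space_def
  using semigroup_C0[of t "apply_bcontfun f"] C0_subset_Cb
  by (intro Bcontfun_inverse) (auto simp: Cb_def bcontfun_def)

lemma T_C0_space: "0 \<le> t \<Longrightarrow> f \<in> C0_space \<Longrightarrow> T t f \<in> C0_space"
  using apply_T[of t f] semigroup_C0[of t "apply_bcontfun f"] by (simp add: C0_space_def)

lemma T_lincomb:
  assumes "0 \<le> t" "f \<in> C0_space" "g \<in> C0_space"
  shows "T t (a *\<^sub>R f + b *\<^sub>R g) = a *\<^sub>R T t f + b *\<^sub>R T t g"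
proof (rule bcontfun_eqI)
  fix x
  have V: "a *\<^sub>R f + b *\<^sub>R g \<in> C0_space"
    using assms subspace_C0_space by (intro subspace_add subspace_scale) auto
  have eq: "apply_bcontfun (a *\<^sub>R f + b *\<^sub>R g) = (\<lambda>x. a * f x + b * g x)" by auto
  show "T t (a *\<^sub>R f + b *\<^sub>R g) x = (a *\<^sub>R T t f + b *\<^sub>R T t g) x"
    using semigroup_lincomb[OF assms(1) bcontfun_Bb[of f] bcontfun_Bb[of g], of a b]
    by (simp add: apply_T[OF assms(1) V] apply_T assms eq del: plus_bcontfun.rep_eq)
       (simp add: apply_T assms)
qed

lemma T_diff: "0 \<le> t \<Longrightarrow> f \<in> C0_space \<Longrightarrow> g \<in> C0_space \<Longrightarrow> T t (f - g) = T t f - T t g"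
  using T_lincomb[of t f g 1 "- 1"] by simp

lemma T_scaleR: "0 \<le> t \<Longrightarrow> f \<in> C0_space \<Longrightarrow> T t (a *\<^sub>R f) = a *\<^sub>R T t f"
  using T_lincomb[of t f f a 0] by simp

lemma T_zero: "f \<in> C0_space \<Longrightarrow> T 0 f = f"
  using semigroup_zero[of "apply_bcontfun f"] bcontfun_Bb[of f]
  by (intro bcontfun_eqI) (simp add: apply_T Bb_def)

lemma T_add: "0 \<le> s \<Longrightarrow> 0 \<le> t \<Longrightarrow> f \<in> C0_space \<Longrightarrow> T (s + t) f = T s (T t f)"
  using semigroup_add[of s t "apply_bcontfun f"] bcontfun_Bb[of f]
  by (intro bcontfun_eqI) (simp add: apply_T T_C0_space)

lemma norm_T_le: "0 \<le> t \<Longrightarrow> f \<in> C0_space \<Longrightarrow> norm (T t f) \<le> norm f"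
  using bcontfun_Bb[of f] norm_bounded[of f]
  by (intro norm_bound) (auto simp: apply_T Bb_def intro!: semigroup_bound)

lemma T_tendsto: "f \<in> C0_space \<Longrightarrow> ((\<lambda>t. T t f) \<longlongrightarrow> f) (at_right 0)"
proof (rule uniform_limit_tendsto_bcontfun)
  assume f: "f \<in> C0_space"
  then have lim: "uniform_limit UNIV (\<lambda>t. S t f) f (at_right 0)"
    by (intro strongly_continuous) (simp add: C0_space_def)
  have ev: "\<forall>\<^sub>F t in at_right 0. \<forall>x\<in>UNIV. S t f x = T t f x"
    using eventually_at_right_less[of 0] by eventually_elim (simp add: apply_T f)
  show "uniform_limit UNIV (\<lambda>t. apply_bcontfun (T t f)) (apply_bcontfun f) (at_right 0)"
    using uniform_limit_cong[OF ev, of "apply_bcontfun f" "apply_bcontfun f"] lim by simp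
qed

lemma T_continuous_on:
  assumes f: "f \<in> C0_space"
  shows "continuous_on {0..} (\<lambda>t. T t f)"
  unfolding continuous_on_iff
proof (intro ballI allI impI)
  fix s e :: real assume s: "s \<in> {0..}" and e: "e > 0"
  have "\<forall>\<^sub>F h in at_right 0. dist (T h f) f < e"
    using T_tendsto[OF f] e by (rule tendstoD)
  then obtain d where d: "d > 0" "\<And>h. 0 < h \<Longrightarrow> h < d \<Longrightarrow> dist (T h f) f < e"
    by (auto simp: eventually_at_right_field)
  \<comment> \<open>Contractivity transports right continuity at 0 to any base point
    \<open>u\<close>. The bound depends only on the gap \<open>v - u\<close>, so using the earlier
    of the two times as base point gives continuity from both sides.\<close>
  have *: "dist (T v f) (T u f) < e" if uv: "0 \<le> u" "u \<le> v" "v - u < d" for u v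
  proof -
    have "norm (T v f - T u f) = norm (T u (T (v - u) f - f))"
      using uv f T_add[of u "v - u" f] by (simp add: T_diff T_C0_space)
    also have "\<dots> \<le> norm (T (v - u) f - f)"
      using uv f by (intro norm_T_le subspace_diff subspace_C0_space T_C0_space) auto
    also have "\<dots> < e"
      using d(2)[of "v - u"] uv e T_zero[OF f] by (cases "u = v") (auto simp: dist_norm)
    finally show ?thesis by (simp add: dist_norm)
  qed
  show "\<exists>d>0. \<forall>t\<in>{0..}. dist t s < d \<longrightarrow> dist (T t f) (T s f) < e"
  proof (intro exI[of _ d] conjI ballI impI)
    fix t :: real assume "t \<in> {0..}" "dist t s < d"
    then show "dist (T t f) (T s f) < e"
      using *[of s t] *[of t s] s by (cases "s \<le> t") (auto simp: dist_real_def dist_commute)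
  qed (fact d(1))
qed

text \<open>\<open>generator Z\<close> expressed in the Banach space, where vector-valued calculus
  applies; \<open>generator_iff_gen\<close> identifies the two.\<close>

definition gen :: "('b \<Rightarrow>\<^sub>C real) \<Rightarrow> ('b \<Rightarrow>\<^sub>C real) \<Rightarrow> bool" where
  "gen f g \<longleftrightarrow> f \<in> C0_space \<and> g \<in> C0_space \<and> ((\<lambda>t. (T t f - f) /\<^sub>R t) \<longlongrightarrow> g) (at_right 0)"

lemma generator_iff_gen:
  "(apply_bcontfun f, apply_bcontfun g) \<in> generator Z \<longleftrightarrow> gen f g"
proof (cases "f \<in> C0_space \<and> g \<in> C0_space")
  case True
  have ev: "\<forall>\<^sub>F t in at_right 0. \<forall>x\<in>UNIV. (S t f x - f x) / t = ((T t f - f) /\<^sub>R t) x"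
    using eventually_at_right_less[of 0]
    by eventually_elim (simp add: apply_T True divide_inverse_commute)
  have "uniform_limit UNIV (\<lambda>t x. (S t f x - f x) / t) g (at_right 0) \<longleftrightarrow>
      uniform_limit UNIV (\<lambda>t. apply_bcontfun ((T t f - f) /\<^sub>R t)) g (at_right 0)"
    using ev by (intro uniform_limit_cong) auto
  also have "\<dots> \<longleftrightarrow> ((\<lambda>t. (T t f - f) /\<^sub>R t) \<longlongrightarrow> g) (at_right 0)"
    by (rule iffI, erule uniform_limit_tendsto_bcontfun, erule tendsto_bcontfun_uniform_limit)
  finally show ?thesis using True by (simp add: generator_def gen_def C0_space_def)
next
  case False
  then show ?thesis by (auto simp: generator_def gen_def C0_space_def)
qed

lemma generatorE:
  assumes "(f, g) \<in> generator Z"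
  obtains F G where "f = apply_bcontfun F" "g = apply_bcontfun G" "gen F G"
proof -
  have "f \<in> C0" "g \<in> C0" using assms by (auto simp: generator_def)
  then obtain F G where "f = apply_bcontfun F" "g = apply_bcontfun G" by (metis C0_bcontfunE)
  with that assms generator_iff_gen show thesis by blast
qed

text \<open>\<open>T t\<close> commutes with the difference quotients and, being a contraction, with
  their limit.\<close>

lemma gen_T:
  assumes "gen f g" "0 \<le> t"
  shows "gen (T t f) (T t g)"
proof -
  have V: "f \<in> C0_space" "g \<in> C0_space" and lim: "((\<lambda>h. (T h f - f) /\<^sub>R h) \<longlongrightarrow> g) (at_right 0)"
    using assms by (auto simp: gen_def)
  have "((\<lambda>h. (T h (T t f) - T t f) /\<^sub>R h) \<longlongrightarrow> T t g) (at_right 0)"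
  proof (rule Lim_transform_bound[THEN Lim_null[THEN iffD2]])
    show "((\<lambda>h. (T h f - f) /\<^sub>R h - g) \<longlongrightarrow> 0) (at_right 0)"
      using lim by (rule LIM_zero)
    show "\<forall>\<^sub>F h in at_right 0. norm ((T h (T t f) - T t f) /\<^sub>R h - T t g) \<le> norm ((T h f - f) /\<^sub>R h - g)"
      using eventually_at_right_less[of 0]
    proof eventually_elim
      case (elim h)
      have W: "(T h f - f) /\<^sub>R h \<in> C0_space"
        using elim V by (intro subspace_scale subspace_diff subspace_C0_space T_C0_space) auto
      have "T h (T t f) = T t (T h f)"
        using elim assms(2) V T_add[of h t f] T_add[of t h f] by (simp add: add.commute)
      then have "(T h (T t f) - T t f) /\<^sub>R h - T t g = T t ((T h f - f) /\<^sub>R h - g)"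
        using elim V assms(2) W by (simp add: T_diff T_scaleR T_C0_space subspace_diff[OF subspace_C0_space])
      also have "norm \<dots> \<le> norm ((T h f - f) /\<^sub>R h - g)"
        using W V assms(2) by (intro norm_T_le subspace_diff subspace_C0_space)
      finally show ?case .
    qed
  qed
  then show ?thesis using V assms(2) by (simp add: gen_def T_C0_space)
qed

text \<open>From the right, the contraction \<open>T t\<close> is applied to the difference quotient
  at 0. From the left only \<open>T (t - h)\<close> factors out, which leaves \<open>T h g\<close>
  where \<open>g\<close> is wanted; strong continuity at \<open>g\<close> absorbs the
  difference.\<close>

lemma T_has_vector_derivative:
  assumes fg: "gen f g" and t: "0 < t"
  shows "((\<lambda>t. T t f) has_vector_derivative T t g) (at t)"
proof -
  have V: "f \<in> C0_space" "g \<in> C0_space" and lim: "((\<lambda>h. (T h f - f) /\<^sub>R h) \<longlongrightarrow> g) (at_right 0)"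
    using fg by (auto simp: gen_def)
  note sub = subspace_diff[OF subspace_C0_space] subspace_scale[OF subspace_C0_space]
  \<comment> \<open>One modulus for both sides; the second term is the extra error from the
    left.\<close>
  define \<eta> where "\<eta> h = norm ((T h f - f) /\<^sub>R h - g) + norm (T h g - g)" for h
  have \<eta>: "(\<eta> \<longlongrightarrow> 0) (at_right 0)"
    unfolding \<eta>_def using tendsto_add[OF tendsto_norm[OF LIM_zero[OF lim]] tendsto_norm[OF LIM_zero[OF T_tendsto[OF V(2)]]]]
    by simp
  have step: "norm (T h f - f - h *\<^sub>R g) = h * norm ((T h f - f) /\<^sub>R h - g)" if "h > 0" for h
  proof -
    have "T h f - f - h *\<^sub>R g = h *\<^sub>R ((T h f - f) /\<^sub>R h - g)"
      using that by (simp add: scaleR_diff_right)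
    then show ?thesis using that by (metis abs_of_pos norm_scaleR)
  qed
  have right: "norm (T (t + h) f - T t f - h *\<^sub>R T t g) \<le> h * \<eta> h" if h: "0 < h" for h
  proof -
    have "T (t + h) f - T t f - h *\<^sub>R T t g = T t (T h f - f - h *\<^sub>R g)"
      using h t V by (simp add: T_add T_diff T_scaleR T_C0_space sub)
    also have "norm \<dots> \<le> norm (T h f - f - h *\<^sub>R g)"
      using h t V by (intro norm_T_le sub T_C0_space) auto
    also have "\<dots> \<le> h * \<eta> h" using step[OF h] h by (simp add: \<eta>_def)
    finally show ?thesis .
  qed
  have left: "norm (T (t - h) f - T t f + h *\<^sub>R T t g) \<le> h * \<eta> h" if h: "0 < h" "h \<le> t" for h
  proof -
    have eq: "T t k = T (t - h) (T h k)" if "k \<in> C0_space" for k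
      using h that T_add[of "t - h" h k] by simp
    have "T (t - h) f - T t f + h *\<^sub>R T t g = T (t - h) (h *\<^sub>R (T h g - g) - (T h f - f - h *\<^sub>R g))"
    proof -
      have *: "h *\<^sub>R (T h g - g) - (T h f - f - h *\<^sub>R g) = h *\<^sub>R T h g - (T h f - f)"
        by (simp add: algebra_simps)
      show ?thesis
        unfolding eq[OF V(1)] eq[OF V(2)] *
        using h V by (simp add: T_diff T_scaleR T_C0_space sub)
    qed
    also have "norm \<dots> \<le> norm (h *\<^sub>R (T h g - g) - (T h f - f - h *\<^sub>R g))"
      using h V by (intro norm_T_le sub T_C0_space) auto
    also have "\<dots> \<le> norm (h *\<^sub>R (T h g - g)) + norm (T h f - f - h *\<^sub>R g)"
      by (rule norm_triangle_ineq4)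
    also have "\<dots> = h * \<eta> h" using step[OF h(1)] h(1) by (simp add: \<eta>_def distrib_left)
    finally show ?thesis .
  qed
  show ?thesis
    unfolding has_vector_derivative_def has_derivative_at_alt
  proof (intro conjI allI impI bounded_linear_scaleR_left)
    fix e :: real assume e: "e > 0"
    obtain d where d: "d > 0" "\<And>h. 0 < h \<Longrightarrow> h < d \<Longrightarrow> \<eta> h < e"
      using order_tendstoD(2)[OF \<eta> e] by (auto simp: eventually_at_right_field)
    show "\<exists>d>0. \<forall>y. norm (y - t) < d \<longrightarrow> norm (T y f - T t f - (y - t) *\<^sub>R T t g) \<le> e * norm (y - t)"
    proof (intro exI[of _ "min d t"] conjI allI impI)
      fix y assume y: "norm (y - t) < min d t"
      consider "y = t" | "y > t" | "y < t" by linarith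
      then show "norm (T y f - T t f - (y - t) *\<^sub>R T t g) \<le> e * norm (y - t)"
      proof cases
        case 2
        then have "norm (T y f - T t f - (y - t) *\<^sub>R T t g) \<le> (y - t) * \<eta> (y - t)"
          using right[of "y - t"] by simp
        also have "\<dots> \<le> (y - t) * e"
          using d(2)[of "y - t"] y 2 by (intro mult_left_mono) auto
        finally show ?thesis using 2 by (simp add: mult.commute)
      next
        case 3
        then have "(t - y) * \<eta> (t - y) \<le> (t - y) * e"
          using d(2)[of "t - y"] y by (intro mult_left_mono) auto
        then show ?thesis using left[of "t - y"] 3 y by (simp add: mult.commute algebra_simps)
      qed simp
    qed (use d(1) t in auto)
  qed
qed

text \<open>\<open>T t\<close> is known to be linear on \<open>C0_space\<close> only, so it cannot
  be moved under the integral as a \<open>bounded_linear\<close> map of the type. Evaluated at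
  \<open>x\<close> it is integration against \<open>kernel Z t x\<close>, which is bounded linear
  everywhere; a substitution then shifts the time.\<close>

lemma T_integral:
  assumes f: "f \<in> C0_space" and t: "0 \<le> t" and h: "0 \<le> h"
  shows "T t (integral {0..h} (\<lambda>s. T s f)) = integral {t..t + h} (\<lambda>s. T s f)"
proof (rule bcontfun_eqI)
  fix x
  have cont: "continuous_on {a..b} (\<lambda>s. T s f)" if "0 \<le> a" for a b
    by (rule continuous_on_subset[OF T_continuous_on[OF f]]) (use that in auto)
  have int: "(\<lambda>s. T s f) integrable_on {a..b}" if "0 \<le> a" for a b
    using cont[OF that] by (rule integrable_continuous_real)
  have V: "integral {0..h} (\<lambda>s. T s f) \<in> C0_space"
    using f by (intro integral_in_closed_subspace cont closed_C0_space subspace_C0_space T_C0_space) auto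
  have bl: "bounded_linear (\<lambda>g :: 'b \<Rightarrow>\<^sub>C real. \<integral>y. g y \<partial>kernel Z t x)"
    using t by (intro bounded_linear_integral_bcontfun prob_kernel sets_kernel)
  have ker: "(\<integral>y. g y \<partial>kernel Z t x) = T t g x" if "g \<in> C0_space" for g :: "'b \<Rightarrow>\<^sub>C real"
    using that t bcontfun_Bb[of g] by (simp add: apply_T semigroup_kernel Bb_def)
  have "T t (integral {0..h} (\<lambda>s. T s f)) x = (\<integral>y. integral {0..h} (\<lambda>s. T s f) y \<partial>kernel Z t x)"
    using ker[OF V] by simp
  also have "\<dots> = integral {0..h} ((\<lambda>g. \<integral>y. apply_bcontfun g y \<partial>kernel Z t x) \<circ> (\<lambda>s. T s f))"
    using integral_linear[OF int[of 0 h] bl] by simp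
  also have "\<dots> = integral {0..h} (\<lambda>s. T (s + t) f x)"
    using f t by (intro integral_cong) (simp add: ker T_C0_space T_add[symmetric] add.commute)
  also have "\<dots> = integral {t..t + h} (\<lambda>s. T s f x)"
  proof -
    have "((\<lambda>s. T s f x) has_integral integral {t..t + h} (\<lambda>s. T s f x)) (cbox t (t + h))"
    proof -
      have "(\<lambda>s. T s f x) integrable_on {t..t + h}"
        using integrable_linear[OF int[OF t, of "t + h"] bounded_linear_apply_bcontfun[of x]]
        by (simp add: o_def)
      then show ?thesis by (simp add: has_integral_integral)
    qed
    from has_integral_affinity'[OF this, of 1 t]
    have "((\<lambda>s. T (s + t) f x) has_integral integral {t..t + h} (\<lambda>s. T s f x)) {0..h}"
      by (simp add: algebra_simps)
    then show ?thesis by (rule integral_unique)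
  qed
  also have "\<dots> = integral {t..t + h} (\<lambda>s. T s f) x"
    using integral_linear[OF int[OF t, of "t + h"] bounded_linear_apply_bcontfun[of x]]
    by (simp add: o_def)
  finally show "T t (integral {0..h} (\<lambda>s. T s f)) x = integral {t..t + h} (\<lambda>s. T s f) x" .
qed

text \<open>The fundamental theorem of calculus at the lower limit. That limit is kept general
  because \<open>gen_average\<close> needs it both at \<open>h\<close> and at 0.\<close>

lemma integral_T_difference_quotient:
  assumes f: "f \<in> C0_space" and h: "0 \<le> h"
  shows "((\<lambda>t. integral {h..h + t} (\<lambda>s. T s f) /\<^sub>R t) \<longlongrightarrow> T h f) (at_right 0)"
proof -
  have "continuous_on {h..h + 1} (\<lambda>s. T s f)"
    by (rule continuous_on_subset[OF T_continuous_on[OF f]]) (use h in auto)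
  from integral_has_vector_derivative[OF this, of h]
  have "((\<lambda>u. integral {h..u} (\<lambda>s. T s f)) has_vector_derivative T h f) (at h within {h..h + 1})"
    by simp
  then have "((\<lambda>u. (1 / norm (u - h)) *\<^sub>R (integral {h..u} (\<lambda>s. T s f) - (integral {h..h} (\<lambda>s. T s f) + (u - h) *\<^sub>R T h f))) \<longlongrightarrow> 0) (at_right h)"
    by (simp add: has_vector_derivative_def has_derivative_within at_within_Icc_at_right)
  moreover have "\<forall>\<^sub>F u in at_right h. (1 / norm (u - h)) *\<^sub>R (integral {h..u} (\<lambda>s. T s f) - (integral {h..h} (\<lambda>s. T s f) + (u - h) *\<^sub>R T h f))
      = integral {h..u} (\<lambda>s. T s f) /\<^sub>R (u - h) - T h f"
    using eventually_at_right_less[of h]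
    by eventually_elim (simp add: scaleR_diff_right divide_inverse)
  ultimately have "((\<lambda>u. integral {h..u} (\<lambda>s. T s f) /\<^sub>R (u - h) - T h f) \<longlongrightarrow> 0) (at_right h)"
    by (rule Lim_transform_eventually)
  then have "((\<lambda>u. integral {h..u} (\<lambda>s. T s f) /\<^sub>R (u - h)) \<longlongrightarrow> T h f) (at_right h)"
    by (rule LIM_zero_cancel)
  then show ?thesis
    by (subst (asm) filterlim_at_right_to_0) (simp add: add.commute)
qed

text \<open>By \<open>T_integral\<close> the semigroup shifts the interval of integration. In the
  difference the common part cancels and leaves integrals of length \<open>t\<close> starting at
  \<open>h\<close> and at 0, whose quotients by \<open>t\<close> converge.\<close>

lemma gen_average:
  assumes f: "f \<in> C0_space" and h: "0 < h"
  shows "gen (integral {0..h} (\<lambda>s. T s f) /\<^sub>R h) ((T h f - f) /\<^sub>R h)"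
proof -
  let ?I = "integral {0..h} (\<lambda>s. T s f)"
  have cont: "continuous_on {a..b} (\<lambda>s. T s f)" if "0 \<le> a" for a b
    by (rule continuous_on_subset[OF T_continuous_on[OF f]]) (use that in auto)
  have int: "(\<lambda>s. T s f) integrable_on {a..b}" if "0 \<le> a" for a b
    using cont[OF that] by (rule integrable_continuous_real)
  have V: "?I \<in> C0_space"
    using f by (intro integral_in_closed_subspace cont closed_C0_space subspace_C0_space T_C0_space) auto
  have "((\<lambda>t. integral {h..h + t} (\<lambda>s. T s f) /\<^sub>R t - integral {0..0 + t} (\<lambda>s. T s f) /\<^sub>R t) \<longlongrightarrow> T h f - T 0 f) (at_right 0)"
    using f h by (intro tendsto_diff integral_T_difference_quotient) auto
  moreover have "\<forall>\<^sub>F t in at_right 0. integral {h..h + t} (\<lambda>s. T s f) /\<^sub>R t - integral {0..0 + t} (\<lambda>s. T s f) /\<^sub>R t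
      = (T t ?I - ?I) /\<^sub>R t"
    using eventually_at_right_less[of 0]
  proof eventually_elim
    case (elim t)
    have "integral {0..t} (\<lambda>s. T s f) + integral {t..t + h} (\<lambda>s. T s f) = integral {0..t + h} (\<lambda>s. T s f)"
      using elim h by (intro Henstock_Kurzweil_Integration.integral_combine int) auto
    moreover have "?I + integral {h..h + t} (\<lambda>s. T s f) = integral {0..h + t} (\<lambda>s. T s f)"
      using elim h by (intro Henstock_Kurzweil_Integration.integral_combine int) auto
    ultimately have "T t ?I - ?I = integral {h..h + t} (\<lambda>s. T s f) - integral {0..t} (\<lambda>s. T s f)"
      using T_integral[OF f, of t h] elim h by (simp add: algebra_simps)
    then show ?case by (simp add: scaleR_diff_right)
  qed
  ultimately have "((\<lambda>t. (T t ?I - ?I) /\<^sub>R t) \<longlongrightarrow> T h f - f) (at_right 0)"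
    using T_zero[OF f] by (simp add: tendsto_cong)
  then have "((\<lambda>t. ((T t ?I - ?I) /\<^sub>R t) /\<^sub>R h) \<longlongrightarrow> (T h f - f) /\<^sub>R h) (at_right 0)"
    by (intro tendsto_intros)
  moreover have "\<forall>\<^sub>F t in at_right 0. ((T t ?I - ?I) /\<^sub>R t) /\<^sub>R h = (T t (?I /\<^sub>R h) - ?I /\<^sub>R h) /\<^sub>R t"
    using eventually_at_right_less[of 0]
    by eventually_elim (simp add: T_scaleR V scaleR_diff_right mult.commute)
  ultimately have "((\<lambda>t. (T t (?I /\<^sub>R h) - ?I /\<^sub>R h) /\<^sub>R t) \<longlongrightarrow> (T h f - f) /\<^sub>R h) (at_right 0)"
    by (simp add: tendsto_cong)
  then show ?thesis
    using V f h by (simp add: gen_def subspace_scale subspace_diff subspace_C0_space T_C0_space)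
qed

lemma gen_dense:
  assumes f: "f \<in> C0_space" and e: "0 < e"
  shows "\<exists>\<phi> \<gamma>. gen \<phi> \<gamma> \<and> norm (\<phi> - f) < e"
proof -
  have "((\<lambda>h. integral {0..0 + h} (\<lambda>s. T s f) /\<^sub>R h) \<longlongrightarrow> T 0 f) (at_right 0)"
    using f by (intro integral_T_difference_quotient) auto
  then have "\<forall>\<^sub>F h in at_right 0. dist (integral {0..h} (\<lambda>s. T s f) /\<^sub>R h) f < e"
    using e T_zero[OF f] by (auto dest: tendstoD)
  then have "\<forall>\<^sub>F h in at_right 0. 0 < h \<and> dist (integral {0..h} (\<lambda>s. T s f) /\<^sub>R h) f < e"
    using eventually_at_right_less[of 0] by eventually_elim auto
  then obtain h where "0 < h" "dist (integral {0..h} (\<lambda>s. T s f) /\<^sub>R h) f < e"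
    using eventually_happens'[OF trivial_limit_at_right_real] by blast
  then show ?thesis using gen_average[OF f] by (auto simp: dist_norm)
qed

end

section \<open>Invariant measures and the \<open>L\<^sup>2\<close> semigroup\<close>

lemma L2_norm_square_inner: "(L2_norm M f)\<^sup>2 = L2_inner M f f"
  unfolding L2_norm_square by (simp add: L2_inner_def power2_eq_square)

lemma feller_process_feller: "feller_process A Z \<Longrightarrow> feller Z"
  by (auto simp: feller_process_def feller_def)

context feller
begin

lemma integral_generator_zero:
  assumes "invariant_measure Z \<mu>" "gen f g"
  shows "(\<integral>x. g x \<partial>\<mu>) = 0"
  using assms by (auto simp: invariant_measure_def generator_iff_gen[symmetric])

text \<open>For a domain vector \<open>\<phi>\<close> the derivative in \<open>s\<close> of the
  integral of \<open>T s \<phi>\<close> is the integral of \<open>T s \<gamma>\<close>, which is 0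
  because \<open>gen_T\<close> keeps the orbit in the domain. Density of the domain and
  contractivity extend this to \<open>C0_space\<close>.\<close>

lemma integral_T:
  assumes inv: "invariant_measure Z \<mu>" and f: "f \<in> C0_space" and t: "0 \<le> t"
  shows "(\<integral>x. T t f x \<partial>\<mu>) = (\<integral>x. f x \<partial>\<mu>)"
proof -
  define m where "m g = (\<integral>x. g x \<partial>\<mu>)" for g :: "'b \<Rightarrow>\<^sub>C real"
  have prob: "prob_space \<mu>" "sets \<mu> = sets borel" using inv by (auto simp: invariant_measure_def)
  interpret prob_space \<mu> by fact
  have bl: "bounded_linear m"
    unfolding m_def by (intro bounded_linear_integral_bcontfun prob)
  interpret m: bounded_linear m by fact
  have m_bound: "\<bar>m g\<bar> \<le> norm g" for g
  proof -
    have "\<bar>m g\<bar> \<le> (\<integral>x. \<bar>g x\<bar> \<partial>\<mu>)" unfolding m_def by (rule integral_abs_bound)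
    also have "\<dots> \<le> (\<integral>x. norm g \<partial>\<mu>)"
      using Bb_integrable[OF prob bcontfun_Bb[of g]] by (intro integral_mono) (auto simp: abs_apply_bcontfun_le)
    finally show ?thesis by (simp add: prob_space)
  qed
  have const: "m (T t \<phi>) = m \<phi>" if gen: "gen \<phi> \<gamma>" for \<phi> \<gamma>
  proof (cases "t = 0")
    case True
    then show ?thesis using gen T_zero by (simp add: gen_def)
  next
    case False
    have V: "\<phi> \<in> C0_space" using gen by (simp add: gen_def)
    have "m (T t \<phi>) = m (T 0 \<phi>)"
    proof (rule DERIV_isconst_end[where f="\<lambda>t. m (T t \<phi>)"])
      show "continuous_on {0..t} (\<lambda>t. m (T t \<phi>))"
        by (intro m.continuous_on continuous_on_subset[OF T_continuous_on[OF V]]) auto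
      fix s :: real assume "0 < s"
      have "m (T s \<gamma>) = 0"
        using integral_generator_zero[OF inv gen_T[OF gen]] \<open>0 < s\<close> by (simp add: m_def)
      then show "DERIV (\<lambda>t. m (T t \<phi>)) s :> 0"
        using bounded_linear.has_vector_derivative[OF bl T_has_vector_derivative[OF gen \<open>0 < s\<close>]]
        by (simp add: has_real_derivative_iff_has_vector_derivative)
    qed (use t False in auto)
    then show ?thesis using T_zero[OF V] by simp
  qed
  have le: "\<bar>m (T t f) - m f\<bar> \<le> e" if e: "0 < e" for e
  proof -
    obtain \<phi> \<gamma> where gen: "gen \<phi> \<gamma>" and close: "norm (\<phi> - f) < e / 2"
      using gen_dense[OF f, of "e / 2"] e by auto
    have V: "\<phi> \<in> C0_space" using gen by (simp add: gen_def)
    have "m (T t f) - m f = m (\<phi> - f) - m (T t (\<phi> - f))"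
      using const[OF gen] V f t by (simp add: T_diff m.diff)
    moreover have "\<bar>m (T t (\<phi> - f))\<bar> \<le> norm (\<phi> - f)"
      using V f t by (intro order_trans[OF m_bound] norm_T_le subspace_diff subspace_C0_space) auto
    ultimately show ?thesis using m_bound[of "\<phi> - f"] close by linarith
  qed
  have "\<bar>m (T t f) - m f\<bar> \<le> 0" by (rule field_le_epsilon) (simp add: le)
  then show ?thesis by (simp add: m_def)
qed

lemma kernel_measurable_invariant:
  "invariant_measure Z \<mu> \<Longrightarrow> 0 \<le> t \<Longrightarrow> kernel Z t \<in> \<mu> \<rightarrow>\<^sub>M prob_algebra borel"
  using kernel_measurable[of t] by (simp add: invariant_measure_def cong: measurable_cong_sets)

lemma invariant_integral_bind:
  assumes inv: "invariant_measure Z \<mu>" and t: "0 \<le> t" and f: "f \<in> Bb"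
  shows "(\<integral>x. f x \<partial>(\<mu> \<bind> kernel Z t)) = (\<integral>x. S t f x \<partial>\<mu>)"
proof -
  interpret prob_space \<mu> using inv by (simp add: invariant_measure_def)
  obtain B where B: "\<And>x. \<bar>f x\<bar> \<le> B" using f by (auto simp: Bb_def bounded_iff)
  have fm: "f \<in> borel_measurable borel" using f by (simp add: Bb_def)
  have "(\<integral>x. f x \<partial>(\<mu> \<bind> kernel Z t)) = (\<integral>x. (\<integral>y. f y \<partial>kernel Z t x) \<partial>\<mu>)"
  proof (rule integral_bind[OF fm])
    show "kernel Z t \<in> \<mu> \<rightarrow>\<^sub>M subprob_algebra borel"
      by (intro measurable_prob_algebraD kernel_measurable_invariant inv t)
    show "AE x in \<mu>. emeasure (kernel Z t x) (space (kernel Z t x)) \<le> ennreal 1"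
      using prob_space.emeasure_space_1[OF prob_kernel[OF t]] by simp
  qed (use B finite_measure_axioms in auto)
  then show ?thesis by (simp add: semigroup_kernel[OF t fm])
qed

text \<open>Both measures integrate \<open>C0\<close> in the same way, which determines them.
  Invariance thereby reaches all Borel functions.\<close>

lemma invariant_bind:
  assumes lc: "locally compact (UNIV :: 'b set)" and inv: "invariant_measure Z \<mu>" and t: "0 \<le> t"
  shows "\<mu> \<bind> kernel Z t = \<mu>"
proof (rule measure_eqI_C0[OF lc])
  show mu: "prob_space \<mu>" "sets \<mu> = sets borel" using inv by (auto simp: invariant_measure_def)
  note K = kernel_measurable_invariant[OF inv t]
  have "\<mu> \<in> space (prob_algebra \<mu>)" using mu by (simp add: space_prob_algebra)
  from prob_space_bind'[OF this K] sets_bind'[OF this K]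
  show "prob_space (\<mu> \<bind> kernel Z t)" "sets (\<mu> \<bind> kernel Z t) = sets borel" .
  fix f :: "'b \<Rightarrow> real" assume "f \<in> C0"
  then obtain F where F: "f = apply_bcontfun F" "F \<in> C0_space" by (rule C0_bcontfunE)
  then show "(\<integral>x. f x \<partial>(\<mu> \<bind> kernel Z t)) = (\<integral>x. f x \<partial>\<mu>)"
    using integral_T[OF inv F(2) t] invariant_integral_bind[OF inv t bcontfun_Bb[of F]] t
    by (simp add: apply_T)
qed

end

locale feller_invariant = feller Z for Z :: "('b::polish_space, 'w) process" +
  fixes \<mu> :: "'b measure"
  assumes locally_compact: "locally compact (UNIV :: 'b set)"
    and invariant: "invariant_measure Z \<mu>"
begin

section \<open>The semigroup as contractions of \<open>L2 \<mu>\<close>\<close>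

lemma prob: "prob_space \<mu>" and sets_mu: "sets \<mu> = sets borel"
  using invariant by (auto simp: invariant_measure_def)

sublocale prob_space \<mu> by (rule prob)

lemma measurable_mu: "f \<in> borel_measurable \<mu> \<longleftrightarrow> f \<in> borel_measurable borel"
  using sets_mu by (simp cong: measurable_cong_sets)

lemma bind_kernel: "0 \<le> t \<Longrightarrow> \<mu> \<bind> kernel Z t = \<mu>"
  by (rule invariant_bind[OF locally_compact invariant])

lemma kernel_subprob: "0 \<le> t \<Longrightarrow> kernel Z t \<in> \<mu> \<rightarrow>\<^sub>M subprob_algebra borel"
  by (intro measurable_prob_algebraD kernel_measurable_invariant invariant)

lemma integral_semigroup: "0 \<le> t \<Longrightarrow> f \<in> Bb \<Longrightarrow> (\<integral>x. S t f x \<partial>\<mu>) = (\<integral>x. f x \<partial>\<mu>)"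
  using invariant_integral_bind[OF invariant, of t f] by (simp add: bind_kernel)

lemma nn_integral_kernel:
  "0 \<le> t \<Longrightarrow> f \<in> borel_measurable borel \<Longrightarrow> (\<integral>\<^sup>+x. \<integral>\<^sup>+y. f y \<partial>kernel Z t x \<partial>\<mu>) = (\<integral>\<^sup>+x. f x \<partial>\<mu>)"
  using nn_integral_bind[OF _ kernel_subprob, of f t] by (simp add: bind_kernel)

text \<open>Jensen's inequality, obtained as Cauchy-Schwarz against the constant 1 in L2 of the
  kernel. In \<open>ennreal\<close> it makes sense at every \<open>x\<close>, also where the right
  side is infinite.\<close>

lemma square_semigroup_le:
  assumes t: "0 \<le> t" and f: "f \<in> borel_measurable borel"
  shows "ennreal ((S t f x)\<^sup>2) \<le> (\<integral>\<^sup>+y. ennreal ((f y)\<^sup>2) \<partial>kernel Z t x)"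
proof (cases "(\<integral>\<^sup>+y. ennreal ((f y)\<^sup>2) \<partial>kernel Z t x) < \<infinity>")
  case True
  interpret K: prob_space "kernel Z t x" by (rule prob_kernel[OF t])
  have fm: "f \<in> borel_measurable (kernel Z t x)"
    using f sets_kernel by (simp cong: measurable_cong_sets)
  then have int: "integrable (kernel Z t x) (\<lambda>y. (f y)\<^sup>2)"
    using True by (simp add: integrable_iff_bounded)
  have L2: "f \<in> L2 (kernel Z t x)" "(\<lambda>_. 1) \<in> L2 (kernel Z t x)"
    using fm int by (auto simp: L2_def)
  have "\<bar>S t f x\<bar> \<le> L2_norm (kernel Z t x) f"
    using L2_Cauchy_Schwarz[OF L2] semigroup_kernel[OF t f]
    by (simp add: L2_inner_def L2_norm_def[of _ "\<lambda>_. 1"] K.prob_space)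
  then have "\<bar>S t f x\<bar>\<^sup>2 \<le> (L2_norm (kernel Z t x) f)\<^sup>2" by (rule power_mono) simp
  then have "(S t f x)\<^sup>2 \<le> (\<integral>y. (f y)\<^sup>2 \<partial>kernel Z t x)"
    by (simp add: L2_norm_square)
  then show ?thesis using int by (simp add: nn_integral_eq_integral)
next
  case False
  then show ?thesis by (simp add: less_top[symmetric])
qed

text \<open>Integrate the Jensen bound over \<open>\<mu>\<close>; by invariance the kernel
  disappears from the right side.\<close>

lemma semigroup_L2:
  assumes t: "0 \<le> t" and f: "f \<in> L2 \<mu>"
  shows "S t f \<in> L2 \<mu>" and "L2_norm \<mu> (S t f) \<le> L2_norm \<mu> f"
proof -
  have fm: "f \<in> borel_measurable borel" using L2_measurable[OF f] by (simp add: measurable_mu)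
  have Sm: "S t f \<in> borel_measurable \<mu>"
    using semigroup_measurable[OF t fm] by (simp add: measurable_mu)
  have "(\<integral>\<^sup>+x. ennreal ((S t f x)\<^sup>2) \<partial>\<mu>) \<le> (\<integral>\<^sup>+x. \<integral>\<^sup>+y. ennreal ((f y)\<^sup>2) \<partial>kernel Z t x \<partial>\<mu>)"
    by (intro nn_integral_mono square_semigroup_le t fm)
  also have "\<dots> = (\<integral>\<^sup>+x. ennreal ((f x)\<^sup>2) \<partial>\<mu>)"
    using fm by (intro nn_integral_kernel t) simp
  also have "\<dots> = ennreal (\<integral>x. (f x)\<^sup>2 \<partial>\<mu>)"
    using L2_square_integrable[OF f] by (intro nn_integral_eq_integral) auto
  finally have le: "(\<integral>\<^sup>+x. ennreal ((S t f x)\<^sup>2) \<partial>\<mu>) \<le> ennreal (\<integral>x. (f x)\<^sup>2 \<partial>\<mu>)" .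
  have int: "integrable \<mu> (\<lambda>x. (S t f x)\<^sup>2)"
    using Sm order.strict_trans1[OF le ennreal_less_top] by (simp add: integrable_iff_bounded)
  then show "S t f \<in> L2 \<mu>" using Sm by (simp add: L2_def)
  have "(\<integral>x. (S t f x)\<^sup>2 \<partial>\<mu>) \<le> (\<integral>x. (f x)\<^sup>2 \<partial>\<mu>)"
    using le int by (simp add: nn_integral_eq_integral ennreal_le_iff)
  then have "(L2_norm \<mu> (S t f))\<^sup>2 \<le> (L2_norm \<mu> f)\<^sup>2" by (simp add: L2_norm_square)
  then show "L2_norm \<mu> (S t f) \<le> L2_norm \<mu> f"
    by (rule power2_le_imp_le) (rule L2_norm_nonneg)
qed

text \<open>The integral of a nonintegrable function is 0 by convention, so \<open>S t\<close> need
  not be additive at every point. By invariance the iterated integral of the absolute value is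
  finite, which confines the bad points to a null set.\<close>

lemma AE_kernel_integrable:
  assumes t: "0 \<le> t" and f: "f \<in> L2 \<mu>"
  shows "AE x in \<mu>. integrable (kernel Z t x) f"
proof -
  have fm: "f \<in> borel_measurable borel" using L2_measurable[OF f] by (simp add: measurable_mu)
  have "(\<integral>\<^sup>+x. \<integral>\<^sup>+y. ennreal (norm (f y)) \<partial>kernel Z t x \<partial>\<mu>) = (\<integral>\<^sup>+x. ennreal (norm (f x)) \<partial>\<mu>)"
    using fm by (intro nn_integral_kernel t) simp
  also have "\<dots> < \<infinity>"
    using L2_integrable[OF finite_measure_axioms f] by (simp add: integrable_iff_bounded)
  finally have "(\<integral>\<^sup>+x. \<integral>\<^sup>+y. ennreal (norm (f y)) \<partial>kernel Z t x \<partial>\<mu>) \<noteq> \<infinity>" by simp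
  moreover have "(\<lambda>x. \<integral>\<^sup>+y. ennreal (norm (f y)) \<partial>kernel Z t x) \<in> borel_measurable \<mu>"
    using fm by (intro measurable_compose[OF kernel_subprob[OF t] nn_integral_measurable_subprob_algebra]) simp
  ultimately have "AE x in \<mu>. (\<integral>\<^sup>+y. ennreal (norm (f y)) \<partial>kernel Z t x) \<noteq> \<infinity>"
    by (intro nn_integral_PInf_AE)
  then show ?thesis
  proof eventually_elim
    case (elim x)
    have "f \<in> borel_measurable (kernel Z t x)"
      using fm sets_kernel by (simp cong: measurable_cong_sets)
    with elim show ?case by (simp add: integrable_iff_bounded less_top)
  qed
qed

lemma AE_semigroup_diff:
  assumes t: "0 \<le> t" and f: "f \<in> L2 \<mu>" and g: "g \<in> L2 \<mu>"
  shows "AE x in \<mu>. S t (\<lambda>x. f x - g x) x = S t f x - S t g x"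
  using AE_kernel_integrable[OF t f] AE_kernel_integrable[OF t g]
proof eventually_elim
  case (elim x)
  have "f \<in> borel_measurable borel" "g \<in> borel_measurable borel"
    using L2_measurable[OF f] L2_measurable[OF g] by (simp_all add: measurable_mu)
  then show ?case using elim by (simp add: semigroup_kernel[OF t])
qed

lemma L2_norm_semigroup_diff:
  assumes t: "0 \<le> t" and f: "f \<in> L2 \<mu>" and g: "g \<in> L2 \<mu>"
  shows "L2_norm \<mu> (\<lambda>x. S t f x - S t g x) \<le> L2_norm \<mu> (\<lambda>x. f x - g x)"
proof -
  note L2 = semigroup_L2(1)[OF t f] semigroup_L2(1)[OF t g]
  have "L2_norm \<mu> (\<lambda>x. S t f x - S t g x) = L2_norm \<mu> (S t (\<lambda>x. f x - g x))"
    using AE_semigroup_diff[OF t f g]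
    by (intro L2_norm_cong_AE L2_measurable L2_diff L2 semigroup_L2(1) t f g) auto
  also have "\<dots> \<le> L2_norm \<mu> (\<lambda>x. f x - g x)"
    by (intro semigroup_L2(2) t L2_diff f g)
  finally show ?thesis .
qed

text \<open>
  Expanding \<open>\<parallel>S\<^sub>t F\<parallel>\<^sup>2 = \<parallel>F + t D\<^sub>t\<parallel>\<^sup>2\<close> with the difference quotient \<open>D\<^sub>t\<close> and dropping
  \<open>t\<^sup>2 \<parallel>D\<^sub>t\<parallel>\<^sup>2\<close> bounds \<open>2 \<langle>F, D\<^sub>t\<rangle>\<close> by the difference quotient of the decay estimate.
\<close>

lemma decay_imp_Poincare:
  assumes FG: "(F, G) \<in> L2_generator Z \<mu>"
    and decay: "\<And>t. 0 < t \<Longrightarrow> (L2_norm \<mu> (S t F))\<^sup>2 \<le> exp (- 2 * \<Lambda> * t) * (L2_norm \<mu> F)\<^sup>2"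
  shows "\<Lambda> * L2_inner \<mu> F F \<le> - L2_inner \<mu> F G"
proof -
  have F: "F \<in> L2 \<mu>" and G: "G \<in> L2 \<mu>"
    and lim: "((\<lambda>t. L2_norm \<mu> (\<lambda>x. (S t F x - F x) / t - G x)) \<longlongrightarrow> 0) (at_right 0)"
    using FG by (auto simp: L2_generator_def)
  define D where "D t = (\<lambda>x. (S t F x - F x) / t)" for t
  have lim_D: "((\<lambda>t. L2_norm \<mu> (\<lambda>x. D t x - G x)) \<longlongrightarrow> 0) (at_right 0)"
    using lim by (simp add: D_def)
  have D: "D t \<in> L2 \<mu>" if "0 < t" for t
    using L2_cmult[OF L2_diff[OF semigroup_L2(1)[OF _ F, of t] F], of "1 / t"] that by (simp add: D_def)
  have "\<forall>\<^sub>F t in at_right 0. norm (L2_inner \<mu> F (D t) - L2_inner \<mu> F G) \<le> norm (L2_norm \<mu> (\<lambda>x. D t x - G x)) * L2_norm \<mu> F"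
    using eventually_at_right_less[of 0]
  proof eventually_elim
    case (elim t)
    have "L2_inner \<mu> F (D t) - L2_inner \<mu> F G = L2_inner \<mu> F (\<lambda>x. D t x - G x)"
      unfolding L2_inner_def using L2_mult_integrable[OF F D[OF elim]] L2_mult_integrable[OF F G]
      by (simp add: right_diff_distrib)
    then show ?case
      using L2_Cauchy_Schwarz[OF F L2_diff[OF D[OF elim] G]]
      by (simp add: mult.commute abs_of_nonneg[OF L2_norm_nonneg])
  qed
  then have "((\<lambda>t. L2_inner \<mu> F (D t) - L2_inner \<mu> F G) \<longlongrightarrow> 0) (at_right 0)"
    by (rule tendsto_0_le[OF lim_D])
  then have lim_inner: "((\<lambda>t. 2 * L2_inner \<mu> F (D t)) \<longlongrightarrow> 2 * L2_inner \<mu> F G) (at_right 0)"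
    by (intro tendsto_mult_left) (rule LIM_zero_cancel)
  have lim_exp: "((\<lambda>t. (exp (- 2 * \<Lambda> * t) - 1) / t * (L2_norm \<mu> F)\<^sup>2) \<longlongrightarrow> - 2 * \<Lambda> * (L2_norm \<mu> F)\<^sup>2) (at_right 0)"
  proof (rule tendsto_mult_right)
    have "((\<lambda>t. exp (- 2 * \<Lambda> * t)) has_real_derivative - 2 * \<Lambda>) (at 0)"
      by (auto intro!: derivative_eq_intros)
    then show "((\<lambda>t. (exp (- 2 * \<Lambda> * t) - 1) / t) \<longlongrightarrow> - 2 * \<Lambda>) (at_right 0)"
      by (auto simp: has_field_derivative_iff intro: tendsto_within_subset)
  qed
  have "2 * L2_inner \<mu> F G \<le> - 2 * \<Lambda> * (L2_norm \<mu> F)\<^sup>2"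
  proof (rule tendsto_le[OF trivial_limit_at_right_real lim_exp lim_inner])
    show "\<forall>\<^sub>F t in at_right 0. 2 * L2_inner \<mu> F (D t) \<le> (exp (- 2 * \<Lambda> * t) - 1) / t * (L2_norm \<mu> F)\<^sup>2"
      using eventually_at_right_less[of 0]
    proof eventually_elim
      case (elim t)
      note int = L2_mult_integrable[OF F D[OF elim]] L2_square_integrable[OF D[OF elim]] L2_square_integrable[OF F]
      have "(S t F x)\<^sup>2 = (F x)\<^sup>2 + 2 * t * (F x * D t x) + t\<^sup>2 * (D t x)\<^sup>2" for x
      proof -
        have "S t F x = F x + t * D t x" using elim by (simp add: D_def)
        then show ?thesis by (simp add: power2_eq_square algebra_simps)
      qed
      then have "(L2_norm \<mu> (S t F))\<^sup>2 = (\<integral>x. (F x)\<^sup>2 + 2 * t * (F x * D t x) + t\<^sup>2 * (D t x)\<^sup>2 \<partial>\<mu>)"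
        by (simp add: L2_norm_square)
      also have "\<dots> = (L2_norm \<mu> F)\<^sup>2 + 2 * t * L2_inner \<mu> F (D t) + t\<^sup>2 * (L2_norm \<mu> (D t))\<^sup>2"
        using int by (simp add: L2_norm_square L2_inner_def)
      also have "\<dots> \<ge> (L2_norm \<mu> F)\<^sup>2 + 2 * t * L2_inner \<mu> F (D t)"
        by simp
      finally have "2 * L2_inner \<mu> F (D t) * t \<le> (exp (- 2 * \<Lambda> * t) - 1) * (L2_norm \<mu> F)\<^sup>2"
        using decay[OF elim] by (simp add: algebra_simps)
      then show ?case using elim by (simp add: pos_le_divide_eq)
    qed
  qed
  then show ?thesis by (simp add: L2_norm_square_inner)
qed

end

section \<open>Couplings and averages\<close>

definition coordinate_average :: "('a \<Rightarrow> real) \<Rightarrow> 'a ^ 'n::finite \<Rightarrow> real" where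
  "coordinate_average f x = 1 / real CARD('n) * (\<Sum>i\<in>UNIV. f (x $ i))"

lemma coordinate_average_const: "coordinate_average (\<lambda>_. c) = (\<lambda>_. c)"
  by (auto simp: coordinate_average_def)

lemma coordinate_average_add:
  "coordinate_average (\<lambda>x. f x + g x) x = coordinate_average f x + coordinate_average g x"
  by (simp add: coordinate_average_def sum.distrib distrib_left)

lemma coordinate_average_diff:
  "coordinate_average (\<lambda>x. f x - g x) x = coordinate_average f x - coordinate_average g x"
  by (simp add: coordinate_average_def sum_subtractf right_diff_distrib)

lemma coordinate_average_cmult:
  "coordinate_average (\<lambda>x. c * f x) x = c * coordinate_average f x"
  by (simp add: coordinate_average_def sum_distrib_left[symmetric] mult.left_commute)

lemma coordinate_average_bound:
  fixes f :: "'a \<Rightarrow> real" and x :: "'a ^ 'n::finite"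
  assumes "\<And>x. \<bar>f x\<bar> \<le> B"
  shows "\<bar>coordinate_average f x\<bar> \<le> B"
proof -
  have "\<bar>\<Sum>i\<in>UNIV. f (x $ i)\<bar> \<le> (\<Sum>i\<in>(UNIV :: 'n set). B)"
    using assms by (intro order_trans[OF sum_abs] sum_mono)
  then show ?thesis by (simp add: coordinate_average_def abs_mult field_simps)
qed

lemma measurable_vec_nth: "(\<lambda>x :: 'a::topological_space ^ 'n. x $ i) \<in> borel \<rightarrow>\<^sub>M borel"
  by (intro borel_measurable_continuous_onI continuous_intros)

lemma coordinate_average_measurable:
  fixes f :: "'a::topological_space \<Rightarrow> real"
  assumes "f \<in> borel_measurable borel"
  shows "(coordinate_average f :: 'a ^ 'n::finite \<Rightarrow> real) \<in> borel_measurable borel"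
  unfolding coordinate_average_def[abs_def]
  by (intro borel_measurable_times borel_measurable_sum borel_measurable_const
      measurable_compose[OF measurable_vec_nth assms])

locale feller_coupling = X: feller_invariant X \<pi> + Y: feller_invariant Y \<mu>
  for X :: "('a::polish_space, 'w) process" and \<pi> :: "'a measure" and Y :: "('a ^ 'n::finite, 'v) process"
    and \<mu> :: "('a ^ 'n) measure" +
  assumes coupling: "is_coupling X Y"
    and unique: "\<And>\<nu>. invariant_measure X \<nu> \<Longrightarrow> \<nu> = \<pi>"
begin

section \<open>Marginals of the coupling and lifting to averages\<close>

abbreviation "avg \<equiv> coordinate_average :: ('a \<Rightarrow> real) \<Rightarrow> 'a ^ 'n \<Rightarrow> real"

text \<open>The coupling property equates laws of whole paths; evaluation at time \<open>t\<close>
  is measurable on path space and extracts the law at that time.\<close>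

lemma kernel_marginal:
  assumes t: "0 \<le> t"
  shows "distr (kernel Y t x) borel (\<lambda>y. y $ i) = kernel X t (x $ i)"
proof -
  let ?P = "\<Pi>\<^sub>M s\<in>{0::real..}. (borel :: 'a measure)"
  have ev: "(\<lambda>\<omega>. \<omega> t) \<in> ?P \<rightarrow>\<^sub>M borel"
    using t by (intro measurable_component_singleton) simp
  have Ym: "(\<lambda>\<omega>. \<lambda>s\<in>{0..}. state Y s \<omega> $ i) \<in> law_from Y x \<rightarrow>\<^sub>M ?P"
    by (intro measurable_restrict measurable_compose[OF Y.state_measurable measurable_vec_nth]) simp
  have Xm: "(\<lambda>\<omega>. \<lambda>s\<in>{0..}. state X s \<omega>) \<in> law_from X (x $ i) \<rightarrow>\<^sub>M ?P"
    by (intro measurable_restrict X.state_measurable) simp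
  have "distr (distr (law_from Y x) ?P (\<lambda>\<omega>. \<lambda>s\<in>{0..}. state Y s \<omega> $ i)) borel (\<lambda>\<omega>. \<omega> t) =
      distr (distr (law_from X (x $ i)) ?P (\<lambda>\<omega>. \<lambda>s\<in>{0..}. state X s \<omega>)) borel (\<lambda>\<omega>. \<omega> t)"
    using coupling by (simp add: is_coupling_def)
  then show ?thesis
    using t by (simp add: distr_distr[OF ev Ym] distr_distr[OF ev Xm] kernel_def
        distr_distr[OF measurable_vec_nth Y.state_measurable] o_def)
qed

text \<open>A change of variables; where \<open>f\<close> is not integrable, both sides take the
  default value 0.\<close>

lemma semigroup_coordinate:
  assumes t: "0 \<le> t" and f: "f \<in> borel_measurable borel"
  shows "semigroup_of Y t (\<lambda>x. f (x $ i)) x = semigroup_of X t f (x $ i)"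
proof -
  have m: "(\<lambda>y :: 'a ^ 'n. y $ i) \<in> kernel Y t x \<rightarrow>\<^sub>M borel"
    using measurable_vec_nth Y.sets_kernel by (simp cong: measurable_cong_sets)
  have "semigroup_of X t f (x $ i) = (\<integral>y. f y \<partial>distr (kernel Y t x) borel (\<lambda>y. y $ i))"
    by (simp add: X.semigroup_kernel[OF t f] kernel_marginal[OF t])
  also have "\<dots> = (\<integral>y. f (y $ i) \<partial>kernel Y t x)"
    by (rule integral_distr[OF m f])
  also have "\<dots> = semigroup_of Y t (\<lambda>x. f (x $ i)) x"
    by (intro Y.semigroup_kernel[symmetric] t measurable_compose[OF measurable_vec_nth f])
  finally show ?thesis by simp
qed

lemma measurable_vec_nth_mu: "(\<lambda>x. x $ i) \<in> \<mu> \<rightarrow>\<^sub>M borel"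
  using measurable_vec_nth Y.sets_mu by (simp cong: measurable_cong_sets)

lemma coordinate_Bb:
  fixes f :: "'a \<Rightarrow> real"
  assumes "f \<in> Bb"
  shows "(\<lambda>x :: 'a ^ 'n. f (x $ i)) \<in> Bb"
proof -
  obtain B where "\<And>x. \<bar>f x\<bar> \<le> B" using assms by (auto simp: Bb_def bounded_iff)
  then show ?thesis
    using assms measurable_compose[OF measurable_vec_nth, of f borel i]
    by (auto simp: Bb_def bounded_iff)
qed

text \<open>Invariance of \<open>\<mu>\<close> makes the integral of \<open>S t F\<close> under the
  marginal constant in \<open>t\<close>, so the difference quotients integrate to 0 and so does
  their limit \<open>G\<close>; uniqueness concludes. A function of one coordinate need not vanish
  at infinity, hence invariance of \<open>\<mu>\<close> enters in its form for bounded Borel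
  functions and not through the generator of \<open>Y\<close>.\<close>

lemma marginal: "distr \<mu> borel (\<lambda>x. x $ i) = \<pi>"
proof (rule unique)
  let ?\<nu> = "distr \<mu> borel (\<lambda>x. x $ i)"
  have \<nu>: "prob_space ?\<nu>" "sets ?\<nu> = sets borel"
    by (auto intro!: Y.prob_space_distr measurable_vec_nth_mu)
  have int: "(\<integral>x. f x \<partial>?\<nu>) = (\<integral>x. f (x $ i) \<partial>\<mu>)" if "f \<in> Bb" for f :: "'a \<Rightarrow> real"
    using that by (intro integral_distr measurable_vec_nth_mu) (auto simp: Bb_def)
  have "(\<integral>x. g x \<partial>?\<nu>) = 0" if "(f, g) \<in> generator X" for f g
  proof -
    from that obtain F G where FG: "f = apply_bcontfun F" "g = apply_bcontfun G" and gen: "X.gen F G"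
      by (rule X.generatorE)
    have V: "F \<in> C0_space" and lim: "((\<lambda>t. (semigroup_bcontfun X t F - F) /\<^sub>R t) \<longlongrightarrow> G) (at_right 0)"
      using gen by (auto simp: X.gen_def)
    interpret m: bounded_linear "\<lambda>f :: 'a \<Rightarrow>\<^sub>C real. \<integral>x. f x \<partial>?\<nu>"
      by (rule bounded_linear_integral_bcontfun[OF \<nu>])
    have inv: "(\<integral>x. semigroup_bcontfun X t F x \<partial>?\<nu>) = (\<integral>x. F x \<partial>?\<nu>)" if "0 < t" for t
    proof -
      have Fm: "apply_bcontfun F \<in> borel_measurable borel" using bcontfun_Bb[of F] by (simp add: Bb_def)
      have "(\<integral>x. semigroup_bcontfun X t F x \<partial>?\<nu>) = (\<integral>x. semigroup_bcontfun X t F (x $ i) \<partial>\<mu>)"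
        by (rule int[OF bcontfun_Bb])
      also have "\<dots> = (\<integral>x. semigroup_of Y t (\<lambda>x. F (x $ i)) x \<partial>\<mu>)"
        using that by (simp add: X.apply_T V semigroup_coordinate Fm)
      also have "\<dots> = (\<integral>x. F x \<partial>?\<nu>)"
        using that by (simp add: Y.integral_semigroup coordinate_Bb bcontfun_Bb int)
      finally show ?thesis .
    qed
    have "((\<lambda>t. \<integral>x. ((semigroup_bcontfun X t F - F) /\<^sub>R t) x \<partial>?\<nu>) \<longlongrightarrow> (\<integral>x. G x \<partial>?\<nu>)) (at_right 0)"
      by (rule m.tendsto[OF lim])
    moreover have "\<forall>\<^sub>F t in at_right 0. (\<integral>x. ((semigroup_bcontfun X t F - F) /\<^sub>R t) x \<partial>?\<nu>) = 0"
      using eventually_at_right_less[of 0]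
      by eventually_elim (simp only: m.scaleR m.diff inv, simp)
    ultimately have "((\<lambda>t. 0) \<longlongrightarrow> (\<integral>x. G x \<partial>?\<nu>)) (at_right (0 :: real))"
      by (rule Lim_transform_eventually)
    then show ?thesis by (simp add: FG tendsto_const_iff)
  qed
  then show "invariant_measure X ?\<nu>" using \<nu> by (auto simp: invariant_measure_def)
qed

lemma integral_coordinate:
  "f \<in> borel_measurable borel \<Longrightarrow> (\<integral>x. f (x $ i) \<partial>\<mu>) = (\<integral>x. f x \<partial>\<pi>)" for f :: "'a \<Rightarrow> real"
  using integral_distr[OF measurable_vec_nth_mu, of f i] by (simp add: marginal)

lemma coordinate_L2:
  assumes "f \<in> L2 \<pi>"
  shows "(\<lambda>x. f (x $ i)) \<in> L2 \<mu>" and "L2_norm \<mu> (\<lambda>x. f (x $ i)) = L2_norm \<pi> f"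
proof -
  have fm: "f \<in> borel_measurable borel"
    using L2_measurable[OF assms] by (simp add: X.measurable_mu)
  have "integrable (distr \<mu> borel (\<lambda>x. x $ i)) (\<lambda>x. (f x)\<^sup>2)"
    using L2_square_integrable[OF assms] by (simp add: marginal)
  then have "integrable \<mu> (\<lambda>x. (f (x $ i))\<^sup>2)"
    using fm by (subst (asm) integrable_distr_eq[OF measurable_vec_nth_mu]) auto
  then show "(\<lambda>x. f (x $ i)) \<in> L2 \<mu>"
    using measurable_compose[OF measurable_vec_nth_mu fm] by (simp add: L2_def)
  show "L2_norm \<mu> (\<lambda>x. f (x $ i)) = L2_norm \<pi> f"
    unfolding L2_norm_def L2_inner_def using fm integral_coordinate[of "\<lambda>x. f x * f x" i] by simp
qed

text \<open>Every coordinate function has the norm of \<open>f\<close>, since all marginals are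
  \<open>\<pi>\<close>; the triangle inequality then works whatever the dependence between
  coordinates.\<close>

lemma avg_L2:
  assumes f: "f \<in> L2 \<pi>"
  shows "avg f \<in> L2 \<mu>" and "L2_norm \<mu> (avg f) \<le> L2_norm \<pi> f" and "(\<integral>x. avg f x \<partial>\<mu>) = (\<integral>x. f x \<partial>\<pi>)"
proof -
  have fm: "f \<in> borel_measurable borel"
    using L2_measurable[OF f] by (simp add: X.measurable_mu)
  have eq: "avg f = (\<lambda>x. 1 / real CARD('n) * (\<Sum>i\<in>UNIV. f (x $ i)))"
    by (simp add: coordinate_average_def fun_eq_iff)
  show "avg f \<in> L2 \<mu>"
    unfolding eq by (intro L2_cmult L2_sum coordinate_L2 f) simp
  have "L2_norm \<mu> (avg f) = 1 / real CARD('n) * L2_norm \<mu> (\<lambda>x. \<Sum>i\<in>UNIV. f (x $ i))"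
    unfolding eq by (subst L2_norm_cmult) simp
  also have "\<dots> \<le> 1 / real CARD('n) * (\<Sum>i\<in>(UNIV :: 'n set). L2_norm \<mu> (\<lambda>x. f (x $ i)))"
    by (intro mult_left_mono L2_norm_sum coordinate_L2 f) auto
  also have "\<dots> = L2_norm \<pi> f" by (simp add: coordinate_L2(2)[OF f])
  finally show "L2_norm \<mu> (avg f) \<le> L2_norm \<pi> f" .
  have "integrable \<mu> (\<lambda>x. f (x $ i))" for i
    by (intro L2_integrable coordinate_L2 f Y.finite_measure_axioms)
  then show "(\<integral>x. avg f x \<partial>\<mu>) = (\<integral>x. f x \<partial>\<pi>)"
    unfolding eq by (simp add: integral_coordinate[OF fm])
qed

lemma semigroup_avg:
  assumes t: "0 \<le> t" and f: "f \<in> Bb"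
  shows "semigroup_of Y t (avg f) x = avg (semigroup_of X t f) x"
proof -
  have fm: "f \<in> borel_measurable borel" using f by (simp add: Bb_def)
  have "avg f \<in> borel_measurable borel" by (rule coordinate_average_measurable[OF fm])
  then have "semigroup_of Y t (avg f) x = (\<integral>y. avg f y \<partial>kernel Y t x)"
    by (rule Y.semigroup_kernel[OF t])
  also have "\<dots> = avg (semigroup_of X t f) x"
    using Y.kernel_integrable[OF t coordinate_Bb[OF f], of x]
    by (simp add: coordinate_average_def semigroup_coordinate[OF t fm, symmetric]
        Y.semigroup_kernel[OF t measurable_compose[OF measurable_vec_nth fm]])
  finally show ?thesis .
qed

text \<open>
  These averages need not vanish at infinity, so they are not in the domain of the generator of
  \<open>Y\<close> on \<open>C\<^sub>0\<close>; but for \<open>\<phi>\<close> in the domain of the generator of \<open>X\<close>, their difference quotients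
  converge uniformly and hence in \<open>L\<^sup>2(\<mu>)\<close>.
\<close>

definition centred_average :: "('a \<Rightarrow>\<^sub>C real) \<Rightarrow> 'a ^ 'n \<Rightarrow> real" where
  "centred_average \<phi> = avg (\<lambda>x. \<phi> x - (\<integral>y. \<phi> y \<partial>\<pi>))"

lemma bcontfun_L2: "apply_bcontfun \<phi> \<in> L2 \<pi>" for \<phi> :: "'a \<Rightarrow>\<^sub>C real"
  by (intro L2_Bb X.finite_measure_axioms X.sets_mu bcontfun_Bb)

lemma const_L2: "(\<lambda>_. c) \<in> L2 \<pi>"
  by (rule L2_bounded[OF X.finite_measure_axioms, of _ "\<bar>c\<bar>"]) auto

lemma centred_average_L2_averages: "centred_average \<phi> \<in> L2_averages \<pi> \<mu>"
proof -
  let ?f = "\<lambda>x. \<phi> x - (\<integral>y. \<phi> y \<partial>\<pi>)"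
  have f: "?f \<in> L2 \<pi>" by (intro L2_diff bcontfun_L2 const_L2)
  have "(\<integral>x. ?f x \<partial>\<pi>) = 0"
    using L2_integrable[OF X.finite_measure_axioms bcontfun_L2[of \<phi>]] by (simp add: X.prob_space)
  then have "?f \<in> L2_mean_zero \<pi>" "avg ?f \<in> L2_mean_zero \<mu>"
    using f avg_L2[OF f] by (simp_all add: L2_mean_zero_def)
  moreover have "AE x in \<mu>. avg ?f x = 1 / real CARD('n) * (\<Sum>i\<in>UNIV. ?f (x $ i))"
    by (simp add: coordinate_average_def)
  ultimately show ?thesis
    unfolding L2_averages_def centred_average_def by (intro CollectI conjI bexI[of _ ?f])
qed

text \<open>The semigroup of \<open>X\<close> fixes constants and preserves the mean, so centring
  commutes with it. Orbits thus stay among centred averages, where the Poincare inequality is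
  available at every time.\<close>

lemma semigroup_centred_average:
  assumes t: "0 \<le> t" and \<phi>: "\<phi> \<in> C0_space"
  shows "semigroup_of Y t (centred_average \<phi>) = centred_average (semigroup_bcontfun X t \<phi>)"
proof
  fix x
  let ?c = "\<integral>y. \<phi> y \<partial>\<pi>"
  have const: "(\<lambda>_. ?c) \<in> Bb" by (auto simp: Bb_def)
  have "semigroup_of Y t (centred_average \<phi>) x = avg (semigroup_of X t (\<lambda>x. \<phi> x - ?c)) x"
    unfolding centred_average_def
    using X.semigroup_lincomb[of 0 \<phi> "\<lambda>_. ?c" 1 "-1"] bcontfun_Bb[of \<phi>] const
    by (intro semigroup_avg t) (auto simp: Bb_def intro!: bounded_minus_comp)
  also have "semigroup_of X t (\<lambda>x. \<phi> x - ?c) = (\<lambda>x. semigroup_bcontfun X t \<phi> x - ?c)"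
  proof -
    have "semigroup_of X t (\<lambda>_. ?c) y = ?c" for y
      using prob_space.prob_space[OF X.prob_kernel[OF t]] by (simp add: X.semigroup_kernel[OF t])
    then show ?thesis
      using X.semigroup_lincomb[OF t bcontfun_Bb[of \<phi>] const, of 1 "-1"] by (simp add: X.apply_T[OF t \<phi>])
  qed
  also have "?c = (\<integral>y. semigroup_bcontfun X t \<phi> y \<partial>\<pi>)"
    by (rule X.integral_T[OF X.invariant \<phi> t, symmetric])
  finally show "semigroup_of Y t (centred_average \<phi>) x = centred_average (semigroup_bcontfun X t \<phi>) x"
    by (simp add: centred_average_def)
qed

lemma centred_average_L2_generator:
  assumes gen: "X.gen \<phi> \<gamma>"
  shows "(centred_average \<phi>, avg \<gamma>) \<in> L2_generator Y \<mu>"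
proof -
  have V: "\<phi> \<in> C0_space" and lim: "((\<lambda>t. (semigroup_bcontfun X t \<phi> - \<phi>) /\<^sub>R t) \<longlongrightarrow> \<gamma>) (at_right 0)"
    using gen by (auto simp: X.gen_def)
  have "((\<lambda>t. L2_norm \<mu> (\<lambda>x. (semigroup_of Y t (centred_average \<phi>) x - centred_average \<phi> x) / t - avg \<gamma> x)) \<longlongrightarrow> 0) (at_right 0)"
  proof (rule Lim_null_comparison)
    show "((\<lambda>t. norm ((semigroup_bcontfun X t \<phi> - \<phi>) /\<^sub>R t - \<gamma>)) \<longlongrightarrow> 0) (at_right 0)"
      using lim by (intro tendsto_norm_zero LIM_zero)
    show "\<forall>\<^sub>F t in at_right 0. norm (L2_norm \<mu> (\<lambda>x. (semigroup_of Y t (centred_average \<phi>) x - centred_average \<phi> x) / t - avg \<gamma> x))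
        \<le> norm ((semigroup_bcontfun X t \<phi> - \<phi>) /\<^sub>R t - \<gamma>)"
      using eventually_at_right_less[of 0]
    proof eventually_elim
      case (elim t)
      let ?d = "(semigroup_bcontfun X t \<phi> - \<phi>) /\<^sub>R t - \<gamma>"
      have "(semigroup_of Y t (centred_average \<phi>) x - centred_average \<phi> x) / t - avg \<gamma> x = avg ?d x" for x
      proof -
        have "apply_bcontfun ?d = (\<lambda>x. (1 / t * (semigroup_bcontfun X t \<phi> x - \<phi> x)) - \<gamma> x)"
          by (auto simp: divide_inverse)
        then have "avg ?d x = 1 / t * (avg (semigroup_bcontfun X t \<phi>) x - avg \<phi> x) - avg \<gamma> x"
          by (simp only: coordinate_average_diff coordinate_average_cmult)
        \<comment> \<open>The means at times \<open>t\<close> and 0 agree, so the centring constants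
          cancel and the limit is the plain average of \<open>\<gamma>\<close>.\<close>
        moreover have "semigroup_of Y t (centred_average \<phi>) x - centred_average \<phi> x
            = avg (semigroup_bcontfun X t \<phi>) x - avg \<phi> x"
          using elim X.integral_T[OF X.invariant V, of t] semigroup_centred_average[OF _ V, of t]
          by (simp add: centred_average_def coordinate_average_diff coordinate_average_const)
        ultimately show ?thesis by simp
      qed
      moreover have "L2_norm \<mu> (avg ?d) \<le> norm ?d"
      proof (rule L2_norm_le_bound[OF Y.prob])
        show "avg ?d \<in> borel_measurable \<mu>"
          using L2_measurable[OF avg_L2(1)[OF bcontfun_L2]] .
        show "\<bar>avg ?d x\<bar> \<le> norm ?d" for x
          by (intro coordinate_average_bound abs_apply_bcontfun_le)
      qed
      ultimately show ?case by (simp add: abs_of_nonneg[OF L2_norm_nonneg] cong: if_cong)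
    qed
  qed
  moreover have "centred_average \<phi> \<in> L2 \<mu>"
    unfolding centred_average_def by (intro avg_L2 L2_diff bcontfun_L2 const_L2)
  ultimately show ?thesis
    using avg_L2(1)[OF bcontfun_L2[of \<gamma>]] by (simp add: L2_generator_def)
qed

text \<open>Supplies the product rule for the squared norm: the orbit is differentiated in sup norm,
  and this form carries the derivative to L2.\<close>

lemma bounded_bilinear_avg_inner:
  "bounded_bilinear (\<lambda>(f :: 'a \<Rightarrow>\<^sub>C real) (g :: 'a \<Rightarrow>\<^sub>C real). L2_inner \<mu> (avg f) (avg g))"
proof -
  have L2: "avg (apply_bcontfun f) \<in> L2 \<mu>" for f
    by (intro avg_L2 bcontfun_L2)
  have int: "integrable \<mu> (\<lambda>x. avg (apply_bcontfun f) x * avg (apply_bcontfun g) x)" for f g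
    by (intro L2_mult_integrable L2)
  have bound: "L2_norm \<mu> (avg (apply_bcontfun f)) \<le> norm f" for f
    by (intro L2_norm_le_bound Y.prob L2_measurable[OF L2] coordinate_average_bound abs_apply_bcontfun_le)
  show ?thesis
  proof (rule bounded_bilinear.intro)
    show "\<exists>K. \<forall>a b. norm (L2_inner \<mu> (avg (apply_bcontfun a)) (avg (apply_bcontfun b))) \<le> norm a * norm b * K"
    proof (intro exI[of _ 1] allI)
      fix a b
      have "\<bar>L2_inner \<mu> (avg (apply_bcontfun a)) (avg (apply_bcontfun b))\<bar> \<le> L2_norm \<mu> (avg (apply_bcontfun a)) * L2_norm \<mu> (avg (apply_bcontfun b))"
        by (rule L2_Cauchy_Schwarz[OF L2 L2])
      also have "\<dots> \<le> norm a * norm b"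
        by (intro mult_mono bound L2_norm_nonneg) auto
      finally show "norm (L2_inner \<mu> (avg (apply_bcontfun a)) (avg (apply_bcontfun b))) \<le> norm a * norm b * 1" by simp
    qed
  qed (use int in \<open>simp_all add: L2_inner_def coordinate_average_add coordinate_average_cmult
      distrib_left distrib_right mult.assoc mult.left_commute[of "avg _ _"]\<close>)
qed

text \<open>By \<open>gen_T\<close> and \<open>centred_average_L2_generator\<close> the average of
  \<open>T s \<gamma>\<close> is the L2 generator applied to the orbit at time \<open>s\<close>. The
  Poincare inequality then says precisely that the derivative, after multiplication by the
  integrating factor, is not positive.\<close>

lemma centred_average_decay:
  assumes Poincare: "\<And>F G. (F, G) \<in> L2_generator Y \<mu> \<Longrightarrow> F \<in> L2_averages \<pi> \<mu> \<Longrightarrow>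
      \<Lambda> * L2_inner \<mu> F F \<le> - L2_inner \<mu> F G"
    and gen: "X.gen \<phi> \<gamma>" and t: "0 \<le> t"
  shows "(L2_norm \<mu> (semigroup_of Y t (centred_average \<phi>)))\<^sup>2 \<le> exp (- 2 * \<Lambda> * t) * (L2_norm \<mu> (centred_average \<phi>))\<^sup>2"
proof -
  interpret Q: bounded_bilinear "\<lambda>(f :: 'a \<Rightarrow>\<^sub>C real) (g :: 'a \<Rightarrow>\<^sub>C real). L2_inner \<mu> (avg f) (avg g)"
    by (rule bounded_bilinear_avg_inner)
  have V: "\<phi> \<in> C0_space" using gen by (simp add: X.gen_def)
  \<comment> \<open>The constant is the mean at time 0 and hence at all times: \<open>h s\<close> is
    the centred function, yet its derivative is that of the orbit alone.\<close>
  define h where "h s = semigroup_bcontfun X s \<phi> - const_bcontfun (\<integral>y. \<phi> y \<partial>\<pi>)" for s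
  define u where "u s = L2_inner \<mu> (avg (h s)) (avg (h s))" for s
  have avg_h: "avg (h s) = centred_average (semigroup_bcontfun X s \<phi>)" if "0 \<le> s" for s
  proof -
    have "apply_bcontfun (h s) = (\<lambda>x. semigroup_bcontfun X s \<phi> x - (\<integral>y. \<phi> y \<partial>\<pi>))"
      by (auto simp: h_def)
    then show ?thesis
      using X.integral_T[OF X.invariant V that] by (simp add: centred_average_def)
  qed
  have u_eq: "u s = (L2_norm \<mu> (semigroup_of Y s (centred_average \<phi>)))\<^sup>2" if "0 \<le> s" for s
    by (simp add: u_def avg_h[OF that] semigroup_centred_average[OF that V] L2_norm_square_inner)
  have "exp (2 * \<Lambda> * t) * u t \<le> exp (2 * \<Lambda> * 0) * u 0"
  \<comment> \<open>The orbit is differentiated at positive times only; the end point 0 is reached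
    by continuity.\<close>
  proof (rule DERIV_nonpos_imp_decreasing_open[where f="\<lambda>s. exp (2 * \<Lambda> * s) * u s"])
    have "continuous_on {0..t} h"
      unfolding h_def by (intro continuous_intros continuous_on_subset[OF X.T_continuous_on[OF V]]) auto
    then show "continuous_on {0..t} (\<lambda>s. exp (2 * \<Lambda> * s) * u s)"
      unfolding u_def by (intro continuous_intros Q.continuous_on)
    fix s :: real assume s: "0 < s"
    have "(h has_vector_derivative semigroup_bcontfun X s \<gamma>) (at s)"
      unfolding h_def using X.T_has_vector_derivative[OF gen s]
      by (auto intro!: derivative_eq_intros)
    from Q.has_vector_derivative[OF this this]
    have "(u has_real_derivative 2 * L2_inner \<mu> (avg (h s)) (avg (semigroup_bcontfun X s \<gamma>))) (at s)"
      by (simp add: u_def[abs_def] has_real_derivative_iff_has_vector_derivative L2_inner_def mult.commute)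
    then have "((\<lambda>s. exp (2 * \<Lambda> * s) * u s) has_real_derivative
        exp (2 * \<Lambda> * s) * (2 * \<Lambda> * u s + 2 * L2_inner \<mu> (avg (h s)) (avg (semigroup_bcontfun X s \<gamma>)))) (at s)"
      by (auto intro!: derivative_eq_intros simp: algebra_simps)
    moreover have "2 * \<Lambda> * u s + 2 * L2_inner \<mu> (avg (h s)) (avg (semigroup_bcontfun X s \<gamma>)) \<le> 0"
      using Poincare[OF centred_average_L2_generator[OF X.gen_T[OF gen]] centred_average_L2_averages, of s] s
      by (simp add: u_def avg_h)
    ultimately show "\<exists>y. ((\<lambda>s. exp (2 * \<Lambda> * s) * u s) has_real_derivative y) (at s) \<and> y \<le> 0"
      by (metis exp_ge_zero mult_nonneg_nonpos)
  qed (fact t)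
  then have "exp (2 * \<Lambda> * t) * u t \<le> u 0" by simp
  then have "exp (- 2 * \<Lambda> * t) * (exp (2 * \<Lambda> * t) * u t) \<le> exp (- 2 * \<Lambda> * t) * u 0"
    by (intro mult_left_mono) auto
  also have "exp (- 2 * \<Lambda> * t) * (exp (2 * \<Lambda> * t) * u t) = u t"
    by (simp add: mult.assoc[symmetric] exp_add[symmetric])
  finally have "u t \<le> exp (- 2 * \<Lambda> * t) * u 0" .
  moreover have "semigroup_of Y 0 (centred_average \<phi>) = centred_average \<phi>"
    using semigroup_centred_average[OF _ V, of 0] X.T_zero[OF V] by simp
  ultimately show ?thesis using u_eq[OF t] u_eq[of 0] by simp
qed

text \<open>Passing from L2 to \<open>C0\<close> and from \<open>C0\<close> to the domain costs
  \<open>e / 4\<close> each. As \<open>f\<close> has mean zero, the mean of \<open>\<phi>\<close> is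
  that of \<open>\<phi> - f\<close>, so centring at most doubles the error, and averaging does not
  increase it.\<close>

lemma centred_average_dense:
  assumes F: "F \<in> L2_averages \<pi> \<mu>" and e: "0 < e"
  obtains \<phi> \<gamma> where "X.gen \<phi> \<gamma>" "L2_norm \<mu> (\<lambda>x. F x - centred_average \<phi> x) < e"
proof -
  obtain f where f: "f \<in> L2 \<pi>" "(\<integral>x. f x \<partial>\<pi>) = 0" and Ff: "AE x in \<mu>. F x = avg f x" and F_L2: "F \<in> L2 \<mu>"
    using F by (auto simp: L2_averages_def L2_mean_zero_def coordinate_average_def)
  obtain g where g: "g \<in> C0" "L2_norm \<pi> (\<lambda>x. f x - g x) < e / 4"
    using C0_dense_L2[OF X.locally_compact X.prob X.sets_mu f(1), of "e / 4"] e by auto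
  obtain g' where g': "g = apply_bcontfun g'" "g' \<in> C0_space" using g(1) by (rule C0_bcontfunE)
  obtain \<phi> \<gamma> where gen: "X.gen \<phi> \<gamma>" and close: "norm (\<phi> - g') < e / 4"
    using X.gen_dense[OF g'(2), of "e / 4"] e by auto
  let ?c = "\<integral>y. \<phi> y \<partial>\<pi>"
  note L2 = f(1) bcontfun_L2[of g'] bcontfun_L2[of \<phi>] const_L2[of ?c] const_L2[of 1]
  have diff: "L2_norm \<pi> (\<lambda>x. f x - \<phi> x) < e / 2"
  proof -
    have "L2_norm \<pi> (\<lambda>x. g' x - \<phi> x) \<le> norm (\<phi> - g')"
      using abs_apply_bcontfun_le[of "\<phi> - g'"]
      by (intro L2_norm_le_bound X.prob L2_measurable L2_diff L2) (simp add: abs_minus_commute)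
    then show ?thesis
      using L2_norm_triangle_diff[OF L2(1,2,3)] g(2) close unfolding g'(1) by linarith
  qed
  have "\<bar>?c\<bar> \<le> L2_norm \<pi> (\<lambda>x. f x - \<phi> x)"
  proof -
    have "?c = - L2_inner \<pi> (\<lambda>x. f x - \<phi> x) (\<lambda>_. 1)"
      unfolding L2_inner_def using L2_integrable[OF X.finite_measure_axioms L2(1)]
        L2_integrable[OF X.finite_measure_axioms L2(3)] f(2) by simp
    then show ?thesis
      using L2_Cauchy_Schwarz[OF L2_diff[OF L2(1,3)] L2(5)]
      by (simp add: L2_norm_def[of _ "\<lambda>_. 1"] L2_inner_def[of _ "\<lambda>_. 1"] X.prob_space)
  qed
  moreover have "L2_norm \<pi> (\<lambda>_. ?c) \<le> \<bar>?c\<bar>"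
    by (intro L2_norm_le_bound X.prob) auto
  moreover have "L2_norm \<pi> (\<lambda>x. f x - (\<phi> x - ?c)) \<le> L2_norm \<pi> (\<lambda>x. f x - \<phi> x) + L2_norm \<pi> (\<lambda>_. ?c)"
    using L2_norm_triangle[OF L2_diff[OF L2(1,3)] L2(4)] by (simp add: algebra_simps)
  ultimately have lt: "L2_norm \<pi> (\<lambda>x. f x - (\<phi> x - ?c)) < e" using diff by linarith
  have "L2_norm \<mu> (\<lambda>x. F x - centred_average \<phi> x) = L2_norm \<mu> (avg (\<lambda>x. f x - (\<phi> x - ?c)))"
  proof (rule L2_norm_cong_AE)
    show "AE x in \<mu>. F x - centred_average \<phi> x = avg (\<lambda>x. f x - (\<phi> x - ?c)) x"
      using Ff by eventually_elim (simp add: centred_average_def coordinate_average_diff)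
  qed (use F_L2 L2 in \<open>simp_all add: L2_measurable L2_diff avg_L2(1) centred_average_def\<close>)
  also have "\<dots> \<le> L2_norm \<pi> (\<lambda>x. f x - (\<phi> x - ?c))"
    by (intro avg_L2 L2_diff L2)
  finally show thesis using that[OF gen] lt by linarith
qed

lemma Poincare_imp_decay:
  assumes Poincare: "\<And>F G. (F, G) \<in> L2_generator Y \<mu> \<Longrightarrow> F \<in> L2_averages \<pi> \<mu> \<Longrightarrow>
      \<Lambda> * L2_inner \<mu> F F \<le> - L2_inner \<mu> F G"
    and t: "0 \<le> t" and F: "F \<in> L2_averages \<pi> \<mu>"
  shows "(L2_norm \<mu> (semigroup_of Y t F))\<^sup>2 \<le> exp (- 2 * \<Lambda> * t) * (L2_norm \<mu> F)\<^sup>2"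
proof -
  have F_L2: "F \<in> L2 \<mu>" using F by (simp add: L2_averages_def L2_mean_zero_def)
  let ?r = "exp (- \<Lambda> * t)"
  have le: "L2_norm \<mu> (semigroup_of Y t F) \<le> ?r * L2_norm \<mu> F + e" if e: "0 < e" for e
  proof -
    \<comment> \<open>The error \<open>?d\<close> enters once through the contraction applied to
      \<open>F\<close> and \<open>?H\<close>, and once with factor \<open>?r\<close> when the norm
      of \<open>?H\<close> is compared with that of \<open>F\<close>; hence the divisor
      \<open>1 + ?r\<close>.\<close>
    obtain \<phi> \<gamma> where gen: "X.gen \<phi> \<gamma>"
      and close: "L2_norm \<mu> (\<lambda>x. F x - centred_average \<phi> x) < e / (1 + ?r)"
      using centred_average_dense[OF F, of "e / (1 + ?r)"] e by (auto simp: add_pos_pos)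
    let ?H = "centred_average \<phi>" and ?d = "L2_norm \<mu> (\<lambda>x. F x - centred_average \<phi> x)"
    have H: "?H \<in> L2 \<mu>"
      using centred_average_L2_averages[of \<phi>] by (simp add: L2_averages_def L2_mean_zero_def)
    note S = Y.semigroup_L2(1)[OF t F_L2] Y.semigroup_L2(1)[OF t H]
    have "L2_norm \<mu> (semigroup_of Y t F)
        \<le> L2_norm \<mu> (\<lambda>x. semigroup_of Y t F x - semigroup_of Y t ?H x) + L2_norm \<mu> (semigroup_of Y t ?H)"
      using L2_norm_triangle[OF L2_diff[OF S] S(2)] by simp
    also have "\<dots> \<le> ?d + ?r * L2_norm \<mu> ?H"
    proof (rule add_mono[OF Y.L2_norm_semigroup_diff[OF t F_L2 H]])
      have "(L2_norm \<mu> (semigroup_of Y t ?H))\<^sup>2 \<le> (?r * L2_norm \<mu> ?H)\<^sup>2"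
        using centred_average_decay[OF Poincare gen t]
        by (simp add: power_mult_distrib exp_double[symmetric] mult.assoc)
      then show "L2_norm \<mu> (semigroup_of Y t ?H) \<le> ?r * L2_norm \<mu> ?H"
        by (rule power2_le_imp_le) (simp add: L2_norm_nonneg)
    qed
    also have "L2_norm \<mu> ?H \<le> L2_norm \<mu> F + ?d"
      using L2_norm_triangle[OF F_L2 L2_diff[OF H F_L2]] L2_norm_diff_commute[of \<mu> F ?H] by simp
    also have "?d + ?r * (L2_norm \<mu> F + ?d) = ?r * L2_norm \<mu> F + ?d * (1 + ?r)"
      by (simp add: algebra_simps)
    also have "?d * (1 + ?r) \<le> e"
      using close by (simp add: pos_less_divide_eq add_pos_pos less_imp_le)
    finally show ?thesis by simp
  qed
  have "L2_norm \<mu> (semigroup_of Y t F) \<le> ?r * L2_norm \<mu> F"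
    by (rule field_le_epsilon) (rule le)
  then have "(L2_norm \<mu> (semigroup_of Y t F))\<^sup>2 \<le> (?r * L2_norm \<mu> F)\<^sup>2"
    by (rule power_mono) (rule L2_norm_nonneg)
  then show ?thesis by (simp add: power_mult_distrib exp_double[symmetric] mult.assoc)
qed

end

theorem theorem67:
  fixes A :: "('a::polish_space, 'm::euclidean_space) chart set"
    and X :: "('a, 'w) process"
    and \<pi> :: "'a measure"
    and Y :: "('a ^ 'n::finite, 'v) process"
    and \<Gamma> :: "('a ^ 'n) op"
    and \<pi>\<^sub>\<Gamma> :: "('a ^ 'n) measure"
    and \<Lambda> :: real
  assumes "locally compact (UNIV :: 'a set)"
    and "smooth_atlas A"
    and "feller_process A X"
    and "is_core (Cc_smooth A) (generator X)"
    and "ergodic X \<pi>"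
    and "\<Gamma> \<in> ergodic_coupling_operators A X Y \<pi>\<^sub>\<Gamma>"
    and "\<Lambda> > 0"
  shows "(\<forall>(F, LF) \<in> L2_generator Y \<pi>\<^sub>\<Gamma>. F \<in> L2_averages \<pi> \<pi>\<^sub>\<Gamma> \<longrightarrow>
            L2_inner \<pi>\<^sub>\<Gamma> F F \<le> 1 / \<Lambda> * L2_inner \<pi>\<^sub>\<Gamma> F (\<lambda>x. - LF x))
     \<longleftrightarrow> (\<forall>t\<ge>0. \<forall>F \<in> L2_averages \<pi> \<pi>\<^sub>\<Gamma>.
            (L2_norm \<pi>\<^sub>\<Gamma> (semigroup_of Y t F))\<^sup>2 \<le> exp (- 2 * \<Lambda> * t) * (L2_norm \<pi>\<^sub>\<Gamma> F)\<^sup>2)"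
proof -
  have Y: "feller_process (product_atlas A) Y" "is_coupling X Y" "invariant_measure Y \<pi>\<^sub>\<Gamma>"
    using assms(6) by (auto simp: ergodic_coupling_operators_def coupling_operators_def ergodic_def)
  have lc: "locally compact (UNIV :: ('a ^ 'n) set)"
    by (rule locally_compact_vec[OF assms(1)])
  have X: "invariant_measure X \<pi>" "\<And>\<nu>. invariant_measure X \<nu> \<Longrightarrow> \<nu> = \<pi>"
    using assms(5) by (auto simp: ergodic_def)
  interpret feller_coupling X \<pi> Y \<pi>\<^sub>\<Gamma>
    using feller_process_feller[OF assms(3)] feller_process_feller[OF Y(1)] Y lc X assms(1)
    by (intro feller_coupling.intro feller_invariant.intro feller_invariant_axioms.intro
        feller_coupling_axioms.intro)
  have Poincare_iff: "L2_inner \<pi>\<^sub>\<Gamma> F F \<le> 1 / \<Lambda> * L2_inner \<pi>\<^sub>\<Gamma> F (\<lambda>x. - G x) \<longleftrightarrow>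
      \<Lambda> * L2_inner \<pi>\<^sub>\<Gamma> F F \<le> - L2_inner \<pi>\<^sub>\<Gamma> F G" for F G
    using assms(7) by (simp add: L2_inner_def field_simps)
  show ?thesis
    unfolding Poincare_iff
  proof (intro iffI allI impI ballI)
    fix t :: real and F
    assume P: "\<forall>(F, LF)\<in>L2_generator Y \<pi>\<^sub>\<Gamma>. F \<in> L2_averages \<pi> \<pi>\<^sub>\<Gamma> \<longrightarrow>
        \<Lambda> * L2_inner \<pi>\<^sub>\<Gamma> F F \<le> - L2_inner \<pi>\<^sub>\<Gamma> F LF"
      and "0 \<le> t" "F \<in> L2_averages \<pi> \<pi>\<^sub>\<Gamma>"
    then show "(L2_norm \<pi>\<^sub>\<Gamma> (semigroup_of Y t F))\<^sup>2 \<le> exp (- 2 * \<Lambda> * t) * (L2_norm \<pi>\<^sub>\<Gamma> F)\<^sup>2"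
      by (intro Poincare_imp_decay) auto
  next
    fix p
    assume decay: "\<forall>t\<ge>0. \<forall>F\<in>L2_averages \<pi> \<pi>\<^sub>\<Gamma>.
        (L2_norm \<pi>\<^sub>\<Gamma> (semigroup_of Y t F))\<^sup>2 \<le> exp (- 2 * \<Lambda> * t) * (L2_norm \<pi>\<^sub>\<Gamma> F)\<^sup>2"
      and p: "p \<in> L2_generator Y \<pi>\<^sub>\<Gamma>"
    show "case p of (F, LF) \<Rightarrow> F \<in> L2_averages \<pi> \<pi>\<^sub>\<Gamma> \<longrightarrow>
        \<Lambda> * L2_inner \<pi>\<^sub>\<Gamma> F F \<le> - L2_inner \<pi>\<^sub>\<Gamma> F LF"
      using p decay by (auto intro!: Y.decay_imp_Poincare)
  qed
qed

end
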